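(* Let $n\ge2$ and let $(S_1,\dots,S_{n-1},P)$ and $(S_1',\dots,S_{n-1}',P')$ be two c.n.u. $\Gamma_n$-contractions acting on Hilbert spaces $\mathcal H$ and $\mathcal H'$ respectively, with $S_i^*P=PS_i^*$ and $S_i'^*P'=P'S_i'^*$ for all $i=1,\dots,n-1$. Suppose $(A_1,\dots,A_{n-1})$ and $(A_1',\dots,A_{n-1}')$ are the $\mathcal F_O$-tuples of $(S_1,\dots,S_{n-1},P)$ and $(S_1',\dots,S_{n-1}',P')$ respectively, while $(B_1,\dots,B_{n-1})$ and $(B_1',\dots,B_{n-1}')$ are the $\mathcal F_O$-tuples of $(S_1^*,\dots,S_{n-1}^*,P^* )$ and $(S_1'^*,\dots,S_{n-1}'^*,P'^* )$ respectively. Then $(S_1,\dots,S_{n-1},P)$ is unitarily equivalent to $(S_1',\dots,S_{n-1}',P')$ if and only if the characteristic tuples $(A_1,\dots,A_{n-1},\Theta_P)$ and $(A_1',\dots,A_{n-1}',\Theta_{P'})$ are C-unitarily equivalent and the $\mathcal F_O$-tuples $(B_1,\dots,B_{n-1})$, $(B_1',\dots,B_{n-1}')$ are C-unitarily equivalent.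
   Context: All operators are bounded and act on complex Hilbert spaces. $\mathbb D$ is the open unit disc. $\Gamma_n=\{(\sum_i z_i,\sum_{i<j}z_iz_j,\dots,\prod_i z_i):|z_i|\le1,\ 1\le i\le n\}\subset\mathbb C^n$. A commuting tuple $(S_1,\dots,S_{n-1},P)$ is a $\Gamma_n$-contraction if $\Gamma_n$ is a spectral set for it: its Taylor joint spectrum lies in $\Gamma_n$ and $\|r(S_1,\dots,S_{n-1},P)\|\le\sup_{\Gamma_n}|r|$ for all rational functions $r$ with poles off $\Gamma_n$. A contraction is c.n.u. (completely non-unitary) if it has no nonzero reducing subspace on which it is unitary; a $\Gamma_n$-contraction is c.n.u. if the contraction $P$ is c.n.u. For a contraction $P$, $D_P=(I-P^*P)^{1/2}$, $\mathcal D_P=\overline{\mathrm{Ran}}\,D_P$. For every $\Gamma_n$-contraction there are unique $A_1,\dots,A_{n-1}\in\mathcal B(\mathcal D_P)$ with $S_i-S_{n-i}^*P=D_PA_iD_P$ ($1\le i\le n-1$); $(A_1,\dots,A_{n-1})$ is its $\mathcal F_O$-tuple. The adjoint tuple is also a $\Gamma_n$-contraction, so its $\mathcal F_O$-tuple consists of operators on $\mathcal D_{P^*}$. The characteristic function of $P$ is $\Theta_P(z)=[-P+zD_{P^*}(I-zP^* )^{-1}D_P]|_{\mathcal D_P}:\mathcal D_P\to\mathcal D_{P^*}$. The characteristic functions of $P$ and $P'$ coincide if there are unitaries $u:\mathcal D_P\to\mathcal D_{P'}$ and $u_*:\mathcal D_{P^*}\to\mathcal D_{P'^*}$ with $u_*\Theta_P(z)=\Theta_{P'}(z)u$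 for all $z\in\mathbb D$. The characteristic tuple of $(S_1,\dots,S_{n-1},P)$ is $(A_1,\dots,A_{n-1},\Theta_P)$. The characteristic tuples of two $\Gamma_n$-contractions are C-unitarily equivalent if $\Theta_P$ and $\Theta_{P'}$ coincide and $uA_i=A_i'u$ for $i=1,\dots,n-1$, where $u:\mathcal D_P\to\mathcal D_{P'}$ is the unitary involved in the coincidence; the $\mathcal F_O$-tuples $(B_1,\dots,B_{n-1})$ and $(B_1',\dots,B_{n-1}')$ of the adjoint tuples are C-unitarily equivalent if $u_*B_i=B_i'u_*$ for $i=1,\dots,n-1$, where $u_*:\mathcal D_{P^*}\to\mathcal D_{P'^*}$ is the unitary involved in the coincidence. When both are required, $u$ and $u_*$ come from one and the same pair $(u,u_* )$ implementing the coincidence of $\Theta_P$ and $\Theta_{P'}$. Two tuples are unitarily equivalent if there is a single unitary $U:\mathcal H\to\mathcal H'$ with $US_i=S_i'U$ for all $i$ and $UP=P'U$. *)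

theory Defs
  imports "HOL-Analysis.Analysis" "HOL-Library.Poly_Mapping"
begin

section \<open>Complex Hilbert spaces\<close>

text \<open>The inner product is linear in the first argument. Its real part is the real inner product
  of the underlying real space, so norm, topology and completeness are the library's.\<close>

class complex_inner = real_inner +
  fixes scaleC :: "complex \<Rightarrow> 'a \<Rightarrow> 'a" (infixr "*\<^sub>C" 75)
    and cinner :: "'a \<Rightarrow> 'a \<Rightarrow> complex"
  assumes scaleC_add_right: "a *\<^sub>C (x + y) = a *\<^sub>C x + a *\<^sub>C y"
    and scaleC_add_left: "(a + b) *\<^sub>C x = a *\<^sub>C x + b *\<^sub>C x"
    and scaleC_scaleC: "a *\<^sub>C b *\<^sub>C x = (a * b) *\<^sub>C x"
    and scaleC_complex_of_real: "complex_of_real r *\<^sub>C x = r *\<^sub>R x"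
    and cinner_commute: "cinner x y = cnj (cinner y x)"
    and cinner_add_left: "cinner (x + y) z = cinner x z + cinner y z"
    and cinner_scaleC_left: "cinner (a *\<^sub>C x) y = a * cinner x y"
    and Re_cinner: "Re (cinner x y) = inner x y"

class complex_hilbert = complex_inner + complete_space

instantiation complex :: complex_hilbert
begin

definition scaleC_complex :: "complex \<Rightarrow> complex \<Rightarrow> complex"
  where "scaleC_complex a x = a * x"

definition cinner_complex :: "complex \<Rightarrow> complex \<Rightarrow> complex"
  where "cinner_complex x y = x * cnj y"

instance
  by standard (auto simp: scaleC_complex_def cinner_complex_def algebra_simps scaleR_conv_of_real
      inner_complex_def)

end


section \<open>Operators\<close>

text \<open>Operators between subspaces are represented by functions on the ambient types; only their
  values on the domain \<open>M\<close> matter. \<open>M = N = UNIV\<close> gives the bounded operators on the whole space,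
  whose norm is the library's \<open>onorm\<close>.\<close>

definition csubspace :: "'a::complex_inner set \<Rightarrow> bool"
  where "csubspace M \<longleftrightarrow> 0 \<in> M \<and> (\<forall>x\<in>M. \<forall>y\<in>M. x + y \<in> M) \<and> (\<forall>c. \<forall>x\<in>M. c *\<^sub>C x \<in> M)"

definition clinear_on :: "'a::complex_inner set \<Rightarrow> ('a \<Rightarrow> 'b::complex_inner) \<Rightarrow> bool"
  where "clinear_on M T \<longleftrightarrow>
    (\<forall>x\<in>M. \<forall>y\<in>M. T (x + y) = T x + T y) \<and> (\<forall>c. \<forall>x\<in>M. T (c *\<^sub>C x) = c *\<^sub>C T x)"

definition bounded_op ::
    "'a::complex_inner set \<Rightarrow> 'b::complex_inner set \<Rightarrow> ('a \<Rightarrow> 'b) \<Rightarrow> bool"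
  where "bounded_op M N T \<longleftrightarrow>
    T ` M \<subseteq> N \<and> clinear_on M T \<and> (\<exists>K. \<forall>x\<in>M. norm (T x) \<le> K * norm x)"

definition unitary_op ::
    "'a::complex_inner set \<Rightarrow> 'b::complex_inner set \<Rightarrow> ('a \<Rightarrow> 'b) \<Rightarrow> bool"
  where "unitary_op M N U \<longleftrightarrow>
    U ` M = N \<and> clinear_on M U \<and> (\<forall>x\<in>M. \<forall>y\<in>M. cinner (U x) (U y) = cinner x y)"

definition adj :: "('a::complex_inner \<Rightarrow> 'b::complex_inner) \<Rightarrow> 'b \<Rightarrow> 'a"
  where "adj T = (THE R. \<forall>x y. cinner (T x) y = cinner x (R y))"

definition positive_op :: "('a::complex_inner \<Rightarrow> 'a) \<Rightarrow> bool"
  where "positive_op T \<longleftrightarrow> bounded_op UNIV UNIV T \<and> (\<forall>x. cinner (T x) x \<in> \<real>\<^sub>\<ge>\<^sub>0)"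

definition sqrt_op :: "('a::complex_inner \<Rightarrow> 'a) \<Rightarrow> 'a \<Rightarrow> 'a"
  where "sqrt_op T = (THE R. positive_op R \<and> R \<circ> R = T)"

definition cnu :: "('a::complex_inner \<Rightarrow> 'a) \<Rightarrow> bool"
  where "cnu P \<longleftrightarrow>
    \<not> (\<exists>M. csubspace M \<and> closed M \<and> M \<noteq> {0} \<and> P ` M \<subseteq> M \<and> adj P ` M \<subseteq> M \<and> unitary_op M M P)"


section \<open>The Taylor joint spectrum\<close>

text \<open>All \<open>n\<close>-tuples are indexed by \<open>{1..n}\<close>; points of complex \<open>n\<close>-space are functions vanishing
  outside \<open>{1..n}\<close>.\<close>

definition cspace :: "nat \<Rightarrow> (nat \<Rightarrow> complex) set"
  where "cspace n = {z. \<forall>i. i \<notin> {1..n} \<longrightarrow> z i = 0}"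

definition commuting_tuple :: "nat \<Rightarrow> (nat \<Rightarrow> 'a::complex_inner \<Rightarrow> 'a) \<Rightarrow> bool"
  where "commuting_tuple n T \<longleftrightarrow>
    (\<forall>i\<in>{1..n}. bounded_op UNIV UNIV (T i)) \<and> (\<forall>i\<in>{1..n}. \<forall>j\<in>{1..n}. T i \<circ> T j = T j \<circ> T i)"

text \<open>The Koszul complex: the space in degree \<open>p\<close> is the tensor product of the Hilbert space with
  the \<open>p\<close>-th exterior power of complex \<open>n\<close>-space. The value of \<open>x\<close> at
  \<open>J = {j\<^sub>1 < \<dots> < j\<^sub>p}\<close> is the coefficient of \<open>e\<^bsub>j\<^sub>1\<^esub> \<and> \<dots> \<and> e\<^bsub>j\<^sub>p\<^esub>\<close>, and the
  differential maps \<open>h \<otimes> e\<close> to the sum of the \<open>T\<^sub>j h \<otimes> (e\<^sub>j \<and> e)\<close>. Integer degrees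
  make the space in degree \<open>-1\<close> zero.\<close>

definition koszul_space :: "nat \<Rightarrow> int \<Rightarrow> (nat set \<Rightarrow> 'a::complex_inner) set"
  where "koszul_space n p = {x. \<forall>J. x J \<noteq> 0 \<longrightarrow> J \<subseteq> {1..n} \<and> int (card J) = p}"

definition koszul_diff ::
    "nat \<Rightarrow> (nat \<Rightarrow> 'a::complex_inner \<Rightarrow> 'a) \<Rightarrow> (nat set \<Rightarrow> 'a) \<Rightarrow> nat set \<Rightarrow> 'a"
  where "koszul_diff n T x J =
    (if J \<subseteq> {1..n} then \<Sum>j\<in>J. (-1) ^ card {i\<in>J. i < j} *\<^sub>R T j (x (J - {j})) else 0)"

definition koszul_exact :: "nat \<Rightarrow> (nat \<Rightarrow> 'a::complex_inner \<Rightarrow> 'a) \<Rightarrow> bool"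
  where "koszul_exact n T \<longleftrightarrow>
    (\<forall>p. {x \<in> koszul_space n p. koszul_diff n T x = (\<lambda>J. 0)} =
      koszul_diff n T ` koszul_space n (p - 1))"

definition taylor_spectrum :: "nat \<Rightarrow> (nat \<Rightarrow> 'a::complex_inner \<Rightarrow> 'a) \<Rightarrow> (nat \<Rightarrow> complex) set"
  where "taylor_spectrum n T =
    {l \<in> cspace n. \<not> koszul_exact n (\<lambda>i x. T i x - l i *\<^sub>C x)}"


section \<open>Spectral sets\<close>

text \<open>Polynomials in the variables \<open>z\<^sub>1, \<dots>, z\<^sub>n\<close>: a monomial is its finitely supported exponent
  function, a polynomial its finitely supported coefficient function.\<close>

type_synonym cpoly = "(nat \<Rightarrow>\<^sub>0 nat) \<Rightarrow>\<^sub>0 complex"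

definition polys :: "nat \<Rightarrow> cpoly set"
  where "polys n = {p. \<forall>m\<in>Poly_Mapping.keys p. Poly_Mapping.keys m \<subseteq> {1..n}}"

definition poly_val :: "cpoly \<Rightarrow> (nat \<Rightarrow> complex) \<Rightarrow> complex"
  where "poly_val p z =
    (\<Sum>m\<in>Poly_Mapping.keys p.
      Poly_Mapping.lookup p m * (\<Prod>i\<in>Poly_Mapping.keys m. z i ^ Poly_Mapping.lookup m i))"

text \<open>The factors commute wherever this is used; the increasing order of the indices is only a
  choice of representative.\<close>

definition monom_op :: "(nat \<Rightarrow>\<^sub>0 nat) \<Rightarrow> (nat \<Rightarrow> 'a \<Rightarrow> 'a) \<Rightarrow> 'a \<Rightarrow> 'a"
  where "monom_op m T =
    foldr (\<lambda>i F. (T i ^^ Poly_Mapping.lookup m i) \<circ> F)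
      (sorted_list_of_set (Poly_Mapping.keys m)) id"

definition poly_op :: "cpoly \<Rightarrow> (nat \<Rightarrow> 'a::complex_inner \<Rightarrow> 'a) \<Rightarrow> 'a \<Rightarrow> 'a"
  where "poly_op p T x = (\<Sum>m\<in>Poly_Mapping.keys p. Poly_Mapping.lookup p m *\<^sub>C monom_op m T x)"

text \<open>A rational function with poles off \<open>X\<close> is \<open>p / q\<close> with \<open>q\<close> zero-free on \<open>X\<close>. Since the Taylor
  spectrum lies in \<open>X\<close>, \<open>q(T)\<close> is invertible by the spectral mapping theorem, and the function
  evaluates at \<open>T\<close> to \<open>p(T) q(T)\<^sup>-\<^sup>1\<close>.\<close>

definition spectral_set ::
    "nat \<Rightarrow> (nat \<Rightarrow> complex) set \<Rightarrow> (nat \<Rightarrow> 'a::complex_inner \<Rightarrow> 'a) \<Rightarrow> bool"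
  where "spectral_set n X T \<longleftrightarrow>
    taylor_spectrum n T \<subseteq> X \<and>
    (\<forall>p\<in>polys n. \<forall>q\<in>polys n. (\<forall>z\<in>X. poly_val q z \<noteq> 0) \<longrightarrow>
      onorm (poly_op p T \<circ> inv (poly_op q T)) \<le> (SUP z\<in>X. cmod (poly_val p z / poly_val q z)))"


section \<open>\<open>\<Gamma>\<^sub>n\<close>-contractions\<close>

definition elem_sym :: "nat \<Rightarrow> nat \<Rightarrow> (nat \<Rightarrow> complex) \<Rightarrow> complex"
  where "elem_sym n k z = (\<Sum>J | J \<subseteq> {1..n} \<and> card J = k. \<Prod>j\<in>J. z j)"

definition Gamma_set :: "nat \<Rightarrow> (nat \<Rightarrow> complex) set"
  where "Gamma_set n =
    {s \<in> cspace n. \<exists>z. (\<forall>i\<in>{1..n}. cmod (z i) \<le> 1) \<and> (\<forall>k\<in>{1..n}. s k = elem_sym n k z)}"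

text \<open>The tuple \<open>(S\<^sub>1, \<dots>, S\<^bsub>n-1\<^esub>, P)\<close> is given by the family \<open>S\<close>, of which only the
  indices \<open>{1..<n}\<close> matter, and \<open>P\<close>, which becomes the entry with index \<open>n\<close>.\<close>

definition Gamma_contraction ::
    "nat \<Rightarrow> (nat \<Rightarrow> 'a::complex_inner \<Rightarrow> 'a) \<Rightarrow> ('a \<Rightarrow> 'a) \<Rightarrow> bool"
  where "Gamma_contraction n S P \<longleftrightarrow>
    commuting_tuple n (S(n := P)) \<and> spectral_set n (Gamma_set n) (S(n := P))"

definition defect_op :: "('a::complex_inner \<Rightarrow> 'a) \<Rightarrow> 'a \<Rightarrow> 'a"
  where "defect_op P = sqrt_op (\<lambda>x. x - adj P (P x))"

definition defect_space :: "('a::complex_inner \<Rightarrow> 'a) \<Rightarrow> 'a set"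
  where "defect_space P = closure (range (defect_op P))"

definition FO_tuple ::
    "nat \<Rightarrow> (nat \<Rightarrow> 'a::complex_inner \<Rightarrow> 'a) \<Rightarrow> ('a \<Rightarrow> 'a) \<Rightarrow> (nat \<Rightarrow> 'a \<Rightarrow> 'a) \<Rightarrow> bool"
  where "FO_tuple n S P A \<longleftrightarrow>
    (\<forall>i\<in>{1..<n}. bounded_op (defect_space P) (defect_space P) (A i) \<and>
      (\<forall>x. S i x - adj (S (n - i)) (P x) = defect_op P (A i (defect_op P x))))"

definition char_fun :: "('a::complex_inner \<Rightarrow> 'a) \<Rightarrow> complex \<Rightarrow> 'a \<Rightarrow> 'a"
  where "char_fun P z x =
    - P x + z *\<^sub>C defect_op (adj P) (inv (\<lambda>y. y - z *\<^sub>C adj P y) (defect_op P x))"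

definition char_fun_coincidence ::
    "('a::complex_inner \<Rightarrow> 'a) \<Rightarrow> ('b::complex_inner \<Rightarrow> 'b) \<Rightarrow> ('a \<Rightarrow> 'b) \<Rightarrow> ('a \<Rightarrow> 'b) \<Rightarrow> bool"
  where "char_fun_coincidence P P' u v \<longleftrightarrow>
    unitary_op (defect_space P) (defect_space P') u \<and>
    unitary_op (defect_space (adj P)) (defect_space (adj P')) v \<and>
    (\<forall>z\<in>ball 0 1. \<forall>x\<in>defect_space P. v (char_fun P z x) = char_fun P' z (u x))"

text \<open>C-unitary equivalence relative to a given coincidence \<open>(u, v)\<close>, where \<open>v\<close> stands for \<open>u\<^sub>*\<close>:
  first for the characteristic tuples \<open>(A, \<Theta>\<^sub>P)\<close> and \<open>(A', \<Theta>\<^sub>P\<^sub>')\<close>, then for the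
  \<open>F\<^sub>O\<close>-tuples \<open>B\<close> and \<open>B'\<close> of the adjoint tuples.\<close>

definition char_tuple_C_equiv ::
    "nat \<Rightarrow> (nat \<Rightarrow> 'a::complex_inner \<Rightarrow> 'a) \<Rightarrow> ('a \<Rightarrow> 'a) \<Rightarrow>
      (nat \<Rightarrow> 'b::complex_inner \<Rightarrow> 'b) \<Rightarrow> ('b \<Rightarrow> 'b) \<Rightarrow> ('a \<Rightarrow> 'b) \<Rightarrow> ('a \<Rightarrow> 'b) \<Rightarrow> bool"
  where "char_tuple_C_equiv n A P A' P' u v \<longleftrightarrow>
    char_fun_coincidence P P' u v \<and>
    (\<forall>i\<in>{1..<n}. \<forall>x\<in>defect_space P. u (A i x) = A' i (u x))"

definition adj_FO_tuple_C_equiv ::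
    "nat \<Rightarrow> (nat \<Rightarrow> 'a::complex_inner \<Rightarrow> 'a) \<Rightarrow> ('a \<Rightarrow> 'a) \<Rightarrow>
      (nat \<Rightarrow> 'b::complex_inner \<Rightarrow> 'b) \<Rightarrow> ('b \<Rightarrow> 'b) \<Rightarrow> ('a \<Rightarrow> 'b) \<Rightarrow> ('a \<Rightarrow> 'b) \<Rightarrow> bool"
  where "adj_FO_tuple_C_equiv n B P B' P' u v \<longleftrightarrow>
    char_fun_coincidence P P' u v \<and>
    (\<forall>i\<in>{1..<n}. \<forall>x\<in>defect_space (adj P). v (B i x) = B' i (v x))"

definition unitarily_equivalent ::
    "nat \<Rightarrow> (nat \<Rightarrow> 'a::complex_inner \<Rightarrow> 'a) \<Rightarrow> ('a \<Rightarrow> 'a) \<Rightarrow>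
      (nat \<Rightarrow> 'b::complex_inner \<Rightarrow> 'b) \<Rightarrow> ('b \<Rightarrow> 'b) \<Rightarrow> bool"
  where "unitarily_equivalent n S P S' P' \<longleftrightarrow>
    (\<exists>U. unitary_op UNIV UNIV U \<and> (\<forall>i\<in>{1..<n}. U \<circ> S i = S' i \<circ> U) \<and> U \<circ> P = P' \<circ> U)"

end

theory Submission
  imports Defs
begin

text \<open>
  A completely non-unitary contraction \<open>P\<close> has \<open>H\<close> as the closed span of the vectors
  \<open>P\<^sup>k D\<^bsub>P*\<^esub> f\<close> and \<open>P*\<^sup>k D\<^sub>P g\<close>. Their Gram matrix is determined by the Taylor coefficients
  \<open>-P\<close> and \<open>D\<^bsub>P*\<^esub> P*\<^sup>k D\<^sub>P\<close> of the characteristic function, so a coincidence \<open>(u, u\<^sub>*)\<close> extends to a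
  unitary \<open>U\<close> with \<open>U P = P' U\<close>; no functional model is needed.
  Put \<open>T\<^sub>i = U S\<^sub>i - S'\<^sub>i U\<close> and \<open>R\<^sub>i = U S\<^sub>i* - S'\<^sub>i* U\<close>. Equivalence of the \<open>F\<^sub>O\<close>-tuples
  gives \<open>T\<^sub>i = R\<^bsub>n-i\<^esub> P\<close> and \<open>R\<^sub>i = T\<^bsub>n-i\<^esub> P*\<close>, so \<open>T\<^sub>i = T\<^sub>i P* P = T\<^sub>i P P*\<close>, that is,
  \<open>T\<^sub>i\<close> annihilates the ranges of \<open>D\<^sub>P\<close> and \<open>D\<^bsub>P*\<^esub>\<close>. Since \<open>T\<^sub>i\<close> intertwines \<open>P, P*\<close> with \<open>P', P'*\<close>,
  it annihilates the spanning vectors, hence \<open>T\<^sub>i = 0\<close>.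
\<close>

text \<open>Write \<open>D\<close>, \<open>E\<close> for the defect operators of \<open>P\<close>
  and \<open>adj P\<close>. Gram products of the vectors \<open>P^m E f\<close> among themselves are
  lowered by \<open><P x, P y> = <x, y> - <D x, D y>\<close>; the correction terms pair vectors
  \<open>D P^j E f\<close>, which are coefficients of the characteristic function of
  \<open>adj P\<close>. Taking adjoints of the given coefficients supplies them, so all hypotheses
  hold equally for \<open>adj P\<close>, \<open>adj P'\<close>, \<open>v\<close>, \<open>u\<close>,
  and the second family needs no separate computation. Complete non-unitarity of \<open>P\<close>
  makes the generators span the domain of \<open>U\<close>, that of \<open>P'\<close> makes
  \<open>U\<close> onto. The commutation of \<open>adj (S i)\<close> with \<open>P\<close> enters
  through \<open>R_i P = P' R_i\<close> and \<open>T_i P* = P'* T_i\<close>: the identity with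
  \<open>P P*\<close> is the chain
  \<open>T_i = R_{n-i} P = P' R_{n-i} = P' T_i P* = T_i P P*\<close>, whose last step uses
  \<open>S_i P = P S_i\<close>. Since \<open>adj\<close> and \<open>sqrt_op\<close> are unique
  descriptions, existence and uniqueness of adjoints and positive square roots have to be proved,
  here by nearest-point projection and by an iteration free of spectral calculus.\<close>

instance complex_hilbert \<subseteq> banach ..

abbreviation bop :: "('a::complex_inner \<Rightarrow> 'b::complex_inner) \<Rightarrow> bool"
  where "bop \<equiv> bounded_op UNIV UNIV"

section \<open>Inner products and adjoints\<close>

lemma scaleC_zero_left [simp]: "0 *\<^sub>C (x::'a::complex_inner) = 0"
  using scaleC_complex_of_real[of 0 x] by simp

lemma scaleC_one [simp]: "1 *\<^sub>C (x::'a::complex_inner) = x"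
  using scaleC_complex_of_real[of 1 x] by simp

lemma scaleC_zero_right [simp]: "a *\<^sub>C (0::'a::complex_inner) = 0"
  using scaleC_add_right[of a "0::'a" 0] by simp

lemma scaleC_minus_right: "a *\<^sub>C (- (x::'a::complex_inner)) = - (a *\<^sub>C x)"
  using scaleC_add_right[of a x "- x"] by (simp add: eq_neg_iff_add_eq_0 add.commute)

lemma scaleC_diff_right: "a *\<^sub>C ((x::'a::complex_inner) - y) = a *\<^sub>C x - a *\<^sub>C y"
  using scaleC_add_right[of a x "- y"] by (simp add: scaleC_minus_right)

lemma scaleC_scaleR: "a *\<^sub>C (r *\<^sub>R (x::'a::complex_inner)) = r *\<^sub>R (a *\<^sub>C x)"
  by (simp flip: scaleC_complex_of_real add: scaleC_scaleC mult.commute)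

lemma cinner_add_right: "cinner (x::'a::complex_inner) (y + z) = cinner x y + cinner x z"
  by (metis cinner_add_left cinner_commute complex_cnj_add)

lemma cinner_scaleC_right: "cinner (x::'a::complex_inner) (a *\<^sub>C y) = cnj a * cinner x y"
  by (metis cinner_scaleC_left cinner_commute complex_cnj_mult)

lemma cinner_diff_right: "cinner (x::'a::complex_inner) (y - z) = cinner x y - cinner x z"
  using cinner_add_right[of x "y - z" z] by simp

text \<open>The complex product is thus determined by the real one and multiplication by
  \<open>\<i>\<close>, so most identities below need only be proved for
  \<open>inner\<close>.\<close>

lemma Im_cinner: "Im (cinner (x::'a::complex_inner) y) = inner x (\<i> *\<^sub>C y)"
  by (simp flip: Re_cinner add: cinner_scaleC_right)

lemma cinner_self: "cinner (x::'a::complex_inner) x = of_real ((norm x)\<^sup>2)"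
proof -
  have "Im (cinner x x) = 0"
    using arg_cong[OF cinner_commute[of x x], of Im] by simp
  thus ?thesis
    by (simp add: complex_eq_iff Re_cinner power2_norm_eq_inner)
qed

lemma inner_scaleC_left: "inner (a *\<^sub>C (x::'a::complex_inner)) y = inner x (cnj a *\<^sub>C y)"
  by (simp flip: Re_cinner add: cinner_scaleC_right cinner_scaleC_left)

lemma Im_cinner_left: "Im (cinner (x::'a::complex_inner) y) = inner ((- \<i>) *\<^sub>C x) y"
  by (simp only: Im_cinner inner_scaleC_left) simp

lemma norm_scaleC: "norm (a *\<^sub>C (x::'a::complex_inner)) = cmod a * norm x"
proof -
  have "of_real ((norm (a *\<^sub>C x))\<^sup>2) = a * cnj a * cinner x x"
    unfolding cinner_self[symmetric] by (simp add: cinner_scaleC_right cinner_scaleC_left)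
  also have "\<dots> = of_real ((cmod a * norm x)\<^sup>2)"
    unfolding cinner_self complex_norm_square[symmetric] by (simp add: power_mult_distrib)
  finally show ?thesis
    by (metis of_real_eq_iff power2_eq_imp_eq norm_ge_zero mult_nonneg_nonneg)
qed

lemma bounded_linear_scaleC: "bounded_linear (\<lambda>x::'a::complex_inner. a *\<^sub>C x)"
  by (rule bounded_linear_intro[where K = "cmod a"])
    (simp_all add: scaleC_add_right scaleC_scaleR norm_scaleC)

text \<open>Reduces complex operators to real \<open>bounded_linear\<close> maps plus complex
  homogeneity, which makes the real theory of limits and continuity available.\<close>

lemma bop_iff: "bop T \<longleftrightarrow> bounded_linear T \<and> (\<forall>c x. T (c *\<^sub>C x) = c *\<^sub>C T x)"
proof
  assume T: "bop T"
  then obtain K where K: "\<And>x. norm (T x) \<le> norm x * K"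
    unfolding bounded_op_def by (auto simp: mult.commute)
  have "T (r *\<^sub>R x) = r *\<^sub>R T x" for r x
    using T unfolding bounded_op_def clinear_on_def by (simp flip: scaleC_complex_of_real)
  with T K show "bounded_linear T \<and> (\<forall>c x. T (c *\<^sub>C x) = c *\<^sub>C T x)"
    by (auto simp: bounded_op_def clinear_on_def intro!: bounded_linear_intro[where K = K])
next
  assume T: "bounded_linear T \<and> (\<forall>c x. T (c *\<^sub>C x) = c *\<^sub>C T x)"
  then obtain K where "\<And>x. norm (T x) \<le> norm x * K"
    using bounded_linear.bounded by blast
  with T show "bop T"
    by (auto simp: bounded_op_def clinear_on_def linear_add[OF bounded_linear.linear] mult.commute
        intro!: exI[of _ K])
qed

lemma bop_bounded_linear: "bop T \<Longrightarrow> bounded_linear T"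
  and bop_scaleC: "bop T \<Longrightarrow> T (c *\<^sub>C x) = c *\<^sub>C T x"
  by (auto simp: bop_iff)

lemma bop_add: "bop T \<Longrightarrow> T (x + y) = T x + T y"
  and bop_diff: "bop T \<Longrightarrow> T (x - y) = T x - T y"
  and bop_zero: "bop T \<Longrightarrow> T 0 = 0"
  and bop_minus: "bop T \<Longrightarrow> T (- x) = - T x"
  and bop_scaleR: "bop T \<Longrightarrow> T (r *\<^sub>R x) = r *\<^sub>R T x"
  and bop_continuous: "bop T \<Longrightarrow> continuous_on M T"
  and bop_tendsto: "bop T \<Longrightarrow> (f \<longlongrightarrow> l) F \<Longrightarrow> ((\<lambda>x. T (f x)) \<longlongrightarrow> T l) F"
  using bop_bounded_linear[of T]
  by (auto simp: linear_add linear_diff linear_0 linear_neg linear_scale bounded_linear.linear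
      linear_continuous_on bounded_linear.tendsto)

lemma bop_compose: "bop T \<Longrightarrow> bop R \<Longrightarrow> bop (\<lambda>x. T (R x))"
  by (auto simp: bop_iff intro: bounded_linear_compose)

lemma bop_sub: "bop T \<Longrightarrow> bop R \<Longrightarrow> bop (\<lambda>x. T x - R x)"
  by (auto simp: bop_iff scaleC_diff_right intro: bounded_linear_sub)

lemma bop_ident: "bop (\<lambda>x. x)"
  by (simp add: bop_iff bounded_linear_ident)

lemma bop_funpow: "bop (T :: 'a::complex_inner \<Rightarrow> 'a) \<Longrightarrow> bop (T ^^ k)"
  by (induction k) (simp_all add: bop_ident[folded id_def] bop_compose comp_def)

section \<open>Orthogonal projection, density and the Riesz representation\<close>

lemma real_orthogonal_projection:
  fixes M :: "'a::{real_inner,complete_space} set"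
  assumes "subspace M" "closed M"
  obtains m where "m \<in> M" "\<And>y. y \<in> M \<Longrightarrow> inner (x - m) y = 0"
proof -
  define d where "d = infdist x M"
  have ne: "M \<noteq> {}" using subspace_0[OF assms(1)] by blast
  have dle: "d \<le> norm (x - y)" if "y \<in> M" for y
    using infdist_le[OF that, of x] by (simp add: d_def dist_norm)
  have d0: "d \<ge> 0" by (simp add: d_def infdist_nonneg)
  have "\<exists>y\<in>M. (norm (x - y))\<^sup>2 < d\<^sup>2 + inverse (real (Suc k))" for k
  proof -
    have "d < sqrt (d\<^sup>2 + inverse (real (Suc k)))"
      using d0 by (intro real_less_rsqrt) auto
    then obtain y where "y \<in> M" "dist x y < sqrt (d\<^sup>2 + inverse (real (Suc k)))"
      using cInf_lessD[of "(\<lambda>a. dist x a) ` M"] ne unfolding d_def infdist_notempty[OF ne] by blast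
    moreover have "(sqrt (d\<^sup>2 + inverse (real (Suc k))))\<^sup>2 = d\<^sup>2 + inverse (real (Suc k))"
      by (simp add: add_nonneg_nonneg)
    ultimately show ?thesis
      by (metis dist_norm norm_ge_zero pos2 power_strict_mono)
  qed
  then obtain f where fM: "\<And>k. f k \<in> M" and f: "\<And>k. (norm (x - f k))\<^sup>2 < d\<^sup>2 + inverse (real (Suc k))"
    by metis
  \<comment> \<open>Parallelogram identity: the midpoint of \<open>f j\<close> and
    \<open>f k\<close> lies in \<open>M\<close>, so its distance from \<open>x\<close> is at least
    \<open>d\<close>.\<close>
  have par: "(norm (f j - f k))\<^sup>2 \<le> 2 * inverse (real (Suc j)) + 2 * inverse (real (Suc k))" for j k
  proof -
    have "(1/2) *\<^sub>R (f j + f k) \<in> M"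
      by (intro subspace_scale subspace_add fM assms)
    hence "d\<^sup>2 \<le> (norm (x - (1/2) *\<^sub>R (f j + f k)))\<^sup>2"
      using dle d0 power_mono by blast
    moreover have "(norm (f j - f k))\<^sup>2 + 4 * (norm (x - (1/2) *\<^sub>R (f j + f k)))\<^sup>2
        = 2 * (norm (x - f j))\<^sup>2 + 2 * (norm (x - f k))\<^sup>2"
      by (simp add: power2_norm_eq_inner inner_diff_left inner_diff_right inner_add_left
          inner_add_right inner_commute algebra_simps)
    ultimately show ?thesis using f[of j] f[of k] by argo
  qed
  have "Cauchy f"
  proof (rule metric_CauchyI)
    fix e :: real assume e: "e > 0"
    then obtain N where N: "inverse (real (Suc N)) < e\<^sup>2 / 4"
      using reals_Archimedean[of "e\<^sup>2 / 4"] by auto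
    have "dist (f j) (f k) < e" if "j \<ge> N" "k \<ge> N" for j k
    proof -
      have "inverse (real (Suc j)) \<le> inverse (real (Suc N))"
          "inverse (real (Suc k)) \<le> inverse (real (Suc N))"
        using that by (auto intro!: le_imp_inverse_le)
      hence "(norm (f j - f k))\<^sup>2 < e\<^sup>2" using par[of j k] N by linarith
      thus ?thesis using e by (simp add: dist_norm power_less_imp_less_base)
    qed
    thus "\<exists>N. \<forall>j\<ge>N. \<forall>k\<ge>N. dist (f j) (f k) < e" by blast
  qed
  then obtain m where m: "f \<longlonglongrightarrow> m" using Cauchy_convergent_iff convergent_def by blast
  have mM: "m \<in> M" using closed_sequentially[OF assms(2)] fM m by blast
  have "(\<lambda>k. (norm (x - f k))\<^sup>2) \<longlonglongrightarrow> (norm (x - m))\<^sup>2"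
    by (intro tendsto_intros m)
  moreover have "(\<lambda>k. d\<^sup>2 + inverse (real (Suc k))) \<longlonglongrightarrow> d\<^sup>2 + 0"
    by (intro tendsto_intros LIMSEQ_inverse_real_of_nat)
  ultimately have md: "(norm (x - m))\<^sup>2 \<le> d\<^sup>2"
    using f LIMSEQ_le[of _ _ _ "d\<^sup>2 + 0"] by (metis (no_types, lifting) add.right_neutral less_imp_le)
  have "inner (x - m) y = 0" if y: "y \<in> M" for y
  proof (cases "y = 0")
    case False
    \<comment> \<open>The minimizer of \<open>norm (x - m - t y)^2\<close> over real
      \<open>t\<close>; the minimum falls below the value at 0 by
      \<open>t * inner (x - m) y\<close>, which minimality of \<open>m\<close> forces to be at most
      0.\<close>
    define t where "t = inner (x - m) y / (norm y)\<^sup>2"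
    have "m + t *\<^sub>R y \<in> M" by (intro subspace_scale subspace_add mM y assms)
    hence "d\<^sup>2 \<le> (norm (x - (m + t *\<^sub>R y)))\<^sup>2" using dle d0 power_mono by blast
    also have "\<dots> = (norm (x - m))\<^sup>2 - 2 * t * inner (x - m) y + t * (t * (norm y)\<^sup>2)"
      by (simp add: power2_norm_eq_inner inner_diff_left inner_diff_right inner_add_left
          inner_add_right inner_commute algebra_simps)
    also have "t * (norm y)\<^sup>2 = inner (x - m) y" using False by (simp add: t_def)
    finally have "t * inner (x - m) y \<le> 0" using md by linarith
    hence "(inner (x - m) y)\<^sup>2 / (norm y)\<^sup>2 \<le> 0" by (simp add: t_def power2_eq_square)
    thus ?thesis using False by (auto simp: divide_le_0_iff)
  qed simp
  with mM that show thesis by blast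
qed

lemma subspace_closure:
  fixes M :: "'a::real_normed_vector set"
  assumes "subspace M"
  shows "subspace (closure M)"
  unfolding subspace_def
proof (intro conjI ballI allI)
  show "0 \<in> closure M" using subspace_0[OF assms] closure_subset by blast
  show "x + y \<in> closure M" if xy: "x \<in> closure M" "y \<in> closure M" for x y
  proof -
    obtain f g where "\<And>n. f n \<in> M" "f \<longlonglongrightarrow> x" "\<And>n. g n \<in> M" "g \<longlonglongrightarrow> y"
      using xy unfolding closure_sequential by blast
    thus ?thesis unfolding closure_sequential
      by (intro exI[of _ "\<lambda>n. f n + g n"]) (auto intro: tendsto_add subspace_add[OF assms])
  qed
  show "c *\<^sub>R x \<in> closure M" if x: "x \<in> closure M" for c x
  proof -
    obtain f where "\<And>n. f n \<in> M" "f \<longlonglongrightarrow> x"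
      using x unfolding closure_sequential by blast
    thus ?thesis unfolding closure_sequential
      by (intro exI[of _ "\<lambda>n. c *\<^sub>R f n"]) (auto intro: tendsto_scaleR subspace_scale[OF assms])
  qed
qed

lemma dense_if_orthogonal_trivial:
  fixes G :: "'a::{real_inner,complete_space} set"
  assumes "\<And>x. (\<And>y. y \<in> G \<Longrightarrow> inner x y = 0) \<Longrightarrow> x = 0"
  shows "closure (span G) = UNIV"
proof (intro equalityI subsetI)
  fix x
  obtain m where m: "m \<in> closure (span G)" "\<And>y. y \<in> closure (span G) \<Longrightarrow> inner (x - m) y = 0"
    using real_orthogonal_projection[of "closure (span G)" x]
        subspace_span closed_closure subspace_closure
    by blast
  have "x - m = 0"
    by (rule assms) (use m(2) closure_subset span_base in blast)
  thus "x \<in> closure (span G)" using m(1) by simp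
qed simp

text \<open>The kernel is a closed hyperplane, and the residual \<open>w\<close> of a point outside
  it spans the orthogonal complement: subtracting \<open>(f y / f w) *\<^sub>R w\<close> from
  \<open>y\<close> lands in the kernel.\<close>

lemma Riesz_representation:
  fixes f :: "'a::{real_inner,complete_space} \<Rightarrow> real"
  assumes "bounded_linear f"
  obtains a where "\<And>x. f x = inner x a"
proof (cases "\<forall>x. f x = 0")
  case True
  thus thesis using that[of 0] by simp
next
  case False
  then obtain x where x: "f x \<noteq> 0" by blast
  interpret bounded_linear f by fact
  have "subspace {y. f y = 0}" by (simp add: subspace_def add scaleR zero)
  moreover have "closed {y. f y = 0}"
    by (intro closed_Collect_eq linear_continuous_on assms continuous_on_const)
  ultimately obtain m where m: "f m = 0" "\<And>y. f y = 0 \<Longrightarrow> inner (x - m) y = 0"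
    using real_orthogonal_projection[of "{y. f y = 0}" x] by auto
  define w where "w = x - m"
  have fw: "f w \<noteq> 0" using m x by (simp add: w_def diff)
  have w0: "inner w w \<noteq> 0" using fw zero by auto
  have "f y = inner y ((f w / inner w w) *\<^sub>R w)" for y
  proof -
    have "f (y - (f y / f w) *\<^sub>R w) = 0" using fw by (simp add: diff scaleR)
    hence "inner w (y - (f y / f w) *\<^sub>R w) = 0" using m(2) w_def by blast
    hence "inner y w = f y / f w * inner w w" by (simp add: inner_diff_right inner_commute)
    thus ?thesis using fw w0 by simp
  qed
  thus thesis using that by blast
qed

section \<open>Existence and properties of adjoints\<close>

lemma cinner_cancel_right:
  fixes y z :: "'a::complex_inner"
  assumes "\<And>x. cinner x y = cinner x z"
  shows "y = z"
  using assms[of "y - z"] cinner_self[of "y - z"] by (simp add: cinner_diff_right)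

lemma adj_unique:
  assumes "\<And>x y. cinner (T x) y = cinner x (R y)"
  shows "adj T = R"
  unfolding adj_def
proof (rule the_equality)
  fix Q assume "\<forall>x y. cinner (T x) y = cinner x (Q y)"
  hence "cinner x (Q y) = cinner x (R y)" for x y
    using assms by metis
  thus "Q = R" by (blast intro: ext cinner_cancel_right)
qed (use assms in blast)

text \<open>Imaginary parts are real inner products with \<open>x\<close> rotated by
  \<open>- \<i>\<close>, and complex homogeneity lets \<open>T\<close> pass the rotation.\<close>

lemma cinner_eq_if_inner_eq:
  assumes "bop T" "\<And>x y. inner (T x) y = inner x (R y)"
  shows "cinner (T x) y = cinner x (R y)"
proof (rule complex_eqI)
  show "Re (cinner (T x) y) = Re (cinner x (R y))" by (simp add: Re_cinner assms)
  from Im_cinner_left[of "T x" y] Im_cinner_left[of x "R y"]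
  show "Im (cinner (T x) y) = Im (cinner x (R y))"
    by (simp only: assms(2) flip: bop_scaleC[OF assms(1)])
qed

lemma adj_exists:
  fixes T :: "'a::complex_hilbert \<Rightarrow> 'b::complex_hilbert"
  assumes "bop T"
  shows "\<exists>R. \<forall>x y. cinner (T x) y = cinner x (R y)"
proof -
  have "\<exists>a. \<forall>x. inner (T x) y = inner x a" for y
    using Riesz_representation[OF bounded_linear_inner_left_comp[OF bop_bounded_linear[OF assms]]]
    by blast
  then obtain R where R: "\<And>x y. inner (T x) y = inner x (R y)" by metis
  with cinner_eq_if_inner_eq[OF assms] show ?thesis by blast
qed

lemma cinner_adj:
  fixes T :: "'a::complex_hilbert \<Rightarrow> 'b::complex_hilbert"
  assumes "bop T"
  shows "cinner (T x) y = cinner x (adj T y)"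
proof -
  obtain R where "\<And>x y. cinner (T x) y = cinner x (R y)"
    using adj_exists[OF assms] by blast
  with adj_unique[of T R] show ?thesis by simp
qed

lemma inner_adj:
  fixes T :: "'a::complex_hilbert \<Rightarrow> 'b::complex_hilbert"
  assumes "bop T"
  shows "inner (T x) y = inner x (adj T y)"
  by (metis Re_cinner assms cinner_adj)

lemma inner_adj':
  fixes T :: "'a::complex_hilbert \<Rightarrow> 'b::complex_hilbert"
  assumes "bop T"
  shows "inner (adj T y) x = inner y (T x)"
  by (metis inner_adj[OF assms] inner_commute)

lemma norm_adj_le:
  fixes T :: "'a::complex_hilbert \<Rightarrow> 'b::complex_hilbert"
  assumes "bop T" "K \<ge> 0" "\<And>x. norm (T x) \<le> K * norm x"
  shows "norm (adj T y) \<le> K * norm y"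
proof (cases "adj T y = 0")
  case False
  have "norm (adj T y) * norm (adj T y) = inner (T (adj T y)) y"
    by (simp add: inner_adj[OF assms(1)] power2_eq_square[symmetric] power2_norm_eq_inner)
  also have "\<dots> \<le> norm (T (adj T y)) * norm y" by (rule norm_cauchy_schwarz)
  also have "\<dots> \<le> K * norm (adj T y) * norm y" by (intro mult_right_mono assms norm_ge_zero)
  finally have "norm (adj T y) * norm (adj T y) \<le> norm (adj T y) * (K * norm y)"
    by (simp add: mult_ac)
  with False show ?thesis by (simp add: mult_le_cancel_left_pos)
qed (use assms(2) in simp)

lemma bop_adj:
  fixes T :: "'a::complex_hilbert \<Rightarrow> 'b::complex_hilbert"
  assumes "bop T"
  shows "bop (adj T)"
proof -
  have "adj T (x + y) = adj T x + adj T y" for x y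
    by (rule cinner_cancel_right) (simp add: cinner_add_right flip: cinner_adj[OF assms])
  moreover have "adj T (c *\<^sub>C x) = c *\<^sub>C adj T x" for c x
    by (rule cinner_cancel_right) (simp add: cinner_scaleC_right flip: cinner_adj[OF assms])
  moreover obtain K where "0 \<le> K" "\<And>x. norm (T x) \<le> norm x * K"
    using bounded_linear.nonneg_bounded[OF bop_bounded_linear[OF assms]] by blast
  hence "norm (adj T y) \<le> K * norm y" for y
    using norm_adj_le[OF assms] by (simp add: mult.commute)
  ultimately show ?thesis
    unfolding bounded_op_def clinear_on_def by auto
qed

lemma adj_adj:
  fixes T :: "'a::complex_hilbert \<Rightarrow> 'b::complex_hilbert"
  assumes "bop T"
  shows "adj (adj T) = T"
  by (rule adj_unique) (metis assms cinner_adj cinner_commute)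

section \<open>Square roots\<close>

lemma bop_half_sum:
  assumes "bop T" "bop R"
  shows "bop (\<lambda>x. (1/2) *\<^sub>R (T x + R x))"
  using assms by (auto simp: bop_iff scaleC_add_right scaleC_scaleR
      intro: bounded_linear_const_scaleR bounded_linear_add)

text \<open>Polarization: the quadratic form is real at \<open>x + w\<close> for every
  \<open>w\<close>, so the imaginary parts of the cross terms cancel;
  \<open>w = \<i> *\<^sub>C y\<close> turns them into real parts.\<close>

lemma positive_op_symmetric:
  assumes "positive_op T"
  shows "inner (T x) y = inner x (T y)"
proof -
  have T: "bop T" and re: "Im (cinner (T z) z) = 0" for z
    using assms by (auto simp: positive_op_def complex_nonneg_Reals_iff)
  have "Im (cinner (T x) w) + Im (cinner (T w) x) = 0" for w
    using re[of "x + w"] re[of x] re[of w]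
    by (simp add: bop_add[OF T] cinner_add_left cinner_add_right)
  from this[of "\<i> *\<^sub>C y"] have "inner (T x) y = inner (T y) x"
    by (simp add: bop_scaleC[OF T] cinner_scaleC_left cinner_scaleC_right Re_cinner)
  thus ?thesis by (simp add: inner_commute)
qed

lemma positive_op_nonneg: "positive_op T \<Longrightarrow> 0 \<le> inner (T x) x"
  by (auto simp: positive_op_def complex_nonneg_Reals_iff Re_cinner)

text \<open>If \<open>T y\<close> were nonzero, moving from \<open>y\<close> a short way against
  \<open>T y\<close> would make the quadratic form negative, since its linear term
  dominates.\<close>

lemma positive_op_kernel:
  assumes "positive_op T" "inner (T y) y = 0"
  shows "T y = 0"
proof -
  have T: "bop T" using assms by (simp add: positive_op_def)
  define c N where "c = inner (T (T y)) (T y)" and "N = inner (T y) (T y)"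
  \<comment> \<open>Any small positive multiple of \<open>N\<close> would do; this choice never
    divides by zero and gives \<open>s * c = N - s\<close>, which eliminates
    \<open>c\<close>.\<close>
  define s where "s = N / (c + 1)"
  have c: "c \<ge> 0" unfolding c_def by (rule positive_op_nonneg[OF assms(1)])
  have "0 \<le> inner (T (y - s *\<^sub>R T y)) (y - s *\<^sub>R T y)"
    by (rule positive_op_nonneg[OF assms(1)])
  also have "\<dots> = s * (s * c) - 2 * s * N"
    using positive_op_symmetric[OF assms(1), of "T y" y] assms(2)
    by (simp add: bop_diff[OF T] bop_scaleR[OF T] inner_diff_left inner_diff_right c_def N_def
        algebra_simps)
  also have "s * c = N - s" using c by (simp add: s_def field_simps)
  finally have "0 \<le> - s * (s + N)" by (simp add: algebra_simps)
  moreover have "N \<ge> 0" by (simp add: N_def)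
  moreover have "s \<ge> 0" using c \<open>N \<ge> 0\<close> by (simp add: s_def)
  ultimately have "s * s = 0" 
    by (smt (verit) mult_nonneg_nonneg mult_minus_left distrib_left)
  hence "N = 0" using c by (simp add: s_def)
  thus ?thesis by (simp add: N_def)
qed

text \<open>\<open>Y = lim Y\<^sub>k\<close> solves \<open>2 Y = X + Y\<^sup>2\<close>, so that \<open>1 - Y\<close> is a square root of \<open>1 - X\<close>.
  The scalar sequence for \<open>X = 1\<close> dominates the increments in norm.\<close>

primrec sqrt_iter :: "('a::real_vector \<Rightarrow> 'a) \<Rightarrow> nat \<Rightarrow> 'a \<Rightarrow> 'a"
  where "sqrt_iter X 0 = (\<lambda>x. 0)"
  | "sqrt_iter X (Suc k) = (\<lambda>x. (1/2) *\<^sub>R (X x + sqrt_iter X k (sqrt_iter X k x)))"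

primrec sqrt_bound :: "nat \<Rightarrow> real"
  where "sqrt_bound 0 = 0"
  | "sqrt_bound (Suc k) = (1 + (sqrt_bound k)\<^sup>2) / 2"

definition sqrt_lim :: "('a::real_normed_vector \<Rightarrow> 'a) \<Rightarrow> 'a \<Rightarrow> 'a"
  where "sqrt_lim X x = lim (\<lambda>k. sqrt_iter X k x)"

lemma sqrt_bound_range: "0 \<le> sqrt_bound k \<and> sqrt_bound k \<le> 1"
  by (induction k) (auto simp: power_le_one)

lemma sqrt_bound_mono: "mono sqrt_bound"
proof (rule incseq_SucI)
  fix k
  have "0 \<le> (1 - sqrt_bound k)\<^sup>2" by simp
  thus "sqrt_bound k \<le> sqrt_bound (Suc k)" by (simp add: power2_diff)
qed

lemma sqrt_bound_Cauchy: "Cauchy sqrt_bound"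
  by (rule convergent_Cauchy, rule Bseq_mono_convergent)
    (use sqrt_bound_range sqrt_bound_mono in \<open>auto intro!: BseqI'[where K = 1] simp: mono_def\<close>)

lemma bop_sqrt_iter: "bop X \<Longrightarrow> bop (sqrt_iter X k)"
proof (induction k)
  case 0
  show ?case by (simp add: bop_iff)
next
  case (Suc k)
  thus ?case using bop_half_sum[of X "\<lambda>x. sqrt_iter X k (sqrt_iter X k x)"]
      bop_compose[of "sqrt_iter X k" "sqrt_iter X k"] by simp
qed

text \<open>An iterate is a polynomial in \<open>X\<close> whose coefficients do not depend on the
  space, so it inherits every intertwining relation of \<open>X\<close>. In the limit, this is how
  square roots are transported between spaces and shown to commute.\<close>

lemma sqrt_iter_intertwine:
  assumes "bop Z" "\<And>x. Z (X x) = X' (Z x)"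
  shows "Z (sqrt_iter X k x) = sqrt_iter X' k (Z x)"
  by (induction k arbitrary: x)
    (simp_all add: assms bop_zero[OF assms(1)] bop_scaleR[OF assms(1)] bop_add[OF assms(1)])

lemma sqrt_iter_commute:
  assumes "bop X"
  shows "sqrt_iter X j (sqrt_iter X k x) = sqrt_iter X k (sqrt_iter X j x)"
  using sqrt_iter_intertwine[of "sqrt_iter X j" X X, OF bop_sqrt_iter[OF assms]]
    sqrt_iter_intertwine[of X X X, OF assms refl] by simp

lemma sqrt_iter_symmetric:
  assumes "\<And>x y. inner (X x) y = inner x (X y)"
  shows "inner (sqrt_iter X k x) y = inner x (sqrt_iter X k y)"
  by (induction k arbitrary: x y) (simp_all add: assms inner_add_left inner_add_right)

section \<open>Convergence of the iteration for a contraction \<open>X\<close>\<close>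

context
  fixes X :: "'a::complex_hilbert \<Rightarrow> 'a"
  assumes X: "bop X" and X_le: "\<And>x. norm (X x) \<le> norm x"
begin

lemma norm_sqrt_iter: "norm (sqrt_iter X k x) \<le> sqrt_bound k * norm x"
proof (induction k arbitrary: x)
  case (Suc k)
  have "norm (sqrt_iter X k (sqrt_iter X k x)) \<le> sqrt_bound k * (sqrt_bound k * norm x)"
    using Suc[of "sqrt_iter X k x"] mult_left_mono[OF Suc[of x], of "sqrt_bound k"]
        sqrt_bound_range[of k]
    by linarith
  hence "norm (X x + sqrt_iter X k (sqrt_iter X k x)) \<le> norm x + sqrt_bound k * (sqrt_bound k * norm x)"
    using X_le[of x] norm_triangle_ineq[of "X x" "sqrt_iter X k (sqrt_iter X k x)"] by linarith
  thus ?case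
    by (simp add: power2_eq_square algebra_simps del: scaleR_add_right)
qed simp

text \<open>The iterates commute, so \<open>Z^2 - Y^2 = (Z + Y) (Z - Y)\<close>; the same
  factorization of the scalar bounds keeps the increments dominated.\<close>

lemma norm_sqrt_iter_step:
  "norm (sqrt_iter X (Suc k) x - sqrt_iter X k x) \<le> (sqrt_bound (Suc k) - sqrt_bound k) * norm x"
proof (induction k arbitrary: x)
  case 0
  thus ?case using X_le[of x] by simp
next
  case (Suc k)
  let ?Y = "sqrt_iter X k" and ?Z = "sqrt_iter X (Suc k)"
  let ?b = "sqrt_bound k" and ?c = "sqrt_bound (Suc k)"
  let ?d = "?Z x - ?Y x"
  note bops = bop_sqrt_iter[OF X, of k] bop_sqrt_iter[OF X, of "Suc k"]
  have "?Z (?Y x) = ?Y (?Z x)" by (rule sqrt_iter_commute[OF X])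
  hence "?Z (?Z x) - ?Y (?Y x) = ?Z ?d + ?Y ?d"
    unfolding bop_diff[OF bops(1)] bop_diff[OF bops(2)] by simp
  moreover have "sqrt_iter X (Suc (Suc k)) x - ?Z x = (1/2) *\<^sub>R (?Z (?Z x) - ?Y (?Y x))"
    using fun_cong[OF sqrt_iter.simps(2)[of X "Suc k"], of x]
        fun_cong[OF sqrt_iter.simps(2)[of X k], of x]
    by (simp only: scaleR_diff_right[symmetric]) simp
  ultimately have "norm (sqrt_iter X (Suc (Suc k)) x - ?Z x) = (1/2) * norm (?Z ?d + ?Y ?d)"
    by simp
  also have "\<dots> \<le> (1/2) * ((?c + ?b) * norm ?d)"
    unfolding distrib_right
    by (intro mult_left_mono order_trans[OF norm_triangle_ineq add_mono] norm_sqrt_iter) simp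
  also have "\<dots> \<le> (1/2) * ((?c + ?b) * ((?c - ?b) * norm x))"
    using Suc[of x] sqrt_bound_range[of k] sqrt_bound_range[of "Suc k"]
    by (intro mult_left_mono) auto
  also have "\<dots> = (sqrt_bound (Suc (Suc k)) - ?c) * norm x"
    using sqrt_bound.simps(2)[of "Suc k"] sqrt_bound.simps(2)[of k]
    by (simp only: left_diff_distrib[symmetric] mult.assoc[symmetric])
        (simp add: power2_eq_square field_simps)
  finally show ?case .
qed

lemma norm_sqrt_iter_diff:
  assumes "j \<le> k"
  shows "norm (sqrt_iter X k x - sqrt_iter X j x) \<le> (sqrt_bound k - sqrt_bound j) * norm x"
  using assms
proof (induction k rule: dec_induct)
  case (step k)
  thus ?case
    using norm_sqrt_iter_step[of k x] norm_triangle_ineq[of "sqrt_iter X (Suc k) x - sqrt_iter X k x"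
      "sqrt_iter X k x - sqrt_iter X j x"]
    by (simp add: left_diff_distrib del: sqrt_iter.simps sqrt_bound.simps)
qed simp

lemma sqrt_iter_LIMSEQ: "(\<lambda>k. sqrt_iter X k x) \<longlonglongrightarrow> sqrt_lim X x"
proof -
  have "Cauchy (\<lambda>k. sqrt_iter X k x)"
  proof (rule metric_CauchyI)
    fix e :: real assume e: "e > 0"
    \<comment> \<open>Adding 1 covers \<open>x = 0\<close> and makes the final estimate
      strict.\<close>
    hence "e / (norm x + 1) > 0" by (simp add: add_nonneg_pos)
    then obtain N where N: "\<And>j k. j \<ge> N \<Longrightarrow> k \<ge> N \<Longrightarrow> dist (sqrt_bound j) (sqrt_bound k) < e / (norm x + 1)"
      using metric_CauchyD[OF sqrt_bound_Cauchy] by blast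
    have *: "norm (sqrt_iter X k x - sqrt_iter X j x) < e" if "j \<ge> N" "k \<ge> j" for j k
    proof -
      have "sqrt_bound k - sqrt_bound j \<le> e / (norm x + 1)"
        using N[of k j] that by (simp add: dist_norm)
      hence "(sqrt_bound k - sqrt_bound j) * norm x \<le> e / (norm x + 1) * norm x"
        by (intro mult_right_mono) auto
      also have "\<dots> = e * (norm x / (norm x + 1))" by simp
      also have "\<dots> < e * 1"
        using e by (intro mult_strict_left_mono) (auto simp: divide_less_eq_1 add_nonneg_pos)
      finally show ?thesis using norm_sqrt_iter_diff[of j k x] that by linarith
    qed
    have "dist (sqrt_iter X j x) (sqrt_iter X k x) < e" if "j \<ge> N" "k \<ge> N" for j k
      using *[of j k] *[of k j] that by (cases "j \<le> k") (auto simp: dist_norm norm_minus_commute)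
    thus "\<exists>N. \<forall>j\<ge>N. \<forall>k\<ge>N. dist (sqrt_iter X j x) (sqrt_iter X k x) < e" by blast
  qed
  thus ?thesis by (simp add: sqrt_lim_def Cauchy_convergent_iff convergent_LIMSEQ_iff)
qed

lemma norm_sqrt_lim: "norm (sqrt_lim X x) \<le> norm x"
proof (rule tendsto_upperbound)
  show "(\<lambda>k. norm (sqrt_iter X k x)) \<longlonglongrightarrow> norm (sqrt_lim X x)"
    by (intro tendsto_norm sqrt_iter_LIMSEQ)
  have "norm (sqrt_iter X k x) \<le> norm x" for k
    using norm_sqrt_iter[of k x] mult_right_mono[of "sqrt_bound k" 1 "norm x"] sqrt_bound_range[of k]
    by simp
  thus "\<forall>\<^sub>F k in sequentially. norm (sqrt_iter X k x) \<le> norm x" by simp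
qed simp

lemma bop_sqrt_lim: "bop (sqrt_lim X)"
proof -
  note it = bop_sqrt_iter[OF X]
  have "sqrt_lim X (x + y) = sqrt_lim X x + sqrt_lim X y" for x y
    by (rule LIMSEQ_unique[OF sqrt_iter_LIMSEQ])
      (simp add: bop_add[OF it] tendsto_add sqrt_iter_LIMSEQ)
  moreover have "sqrt_lim X (c *\<^sub>C x) = c *\<^sub>C sqrt_lim X x" for c x
    by (rule LIMSEQ_unique[OF sqrt_iter_LIMSEQ])
      (simp add: bop_scaleC[OF it] bounded_linear.tendsto[OF bounded_linear_scaleC] sqrt_iter_LIMSEQ)
  ultimately show ?thesis
    unfolding bounded_op_def clinear_on_def using norm_sqrt_lim by (auto intro: exI[of _ 1])
qed

text \<open>The limit of the recursion. In \<open>Y_k (Y_k x)\<close> both the operator and its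
  argument move; since the \<open>Y_k\<close> have norm at most 1, replacing the argument by its
  limit costs a term tending to 0.\<close>

lemma sqrt_lim_eq: "sqrt_lim X x = (1/2) *\<^sub>R (X x + sqrt_lim X (sqrt_lim X x))"
proof -
  let ?Y = "sqrt_lim X"
  have "(\<lambda>k. sqrt_iter X k (sqrt_iter X k x - ?Y x)) \<longlonglongrightarrow> 0"
  proof (rule Lim_null_comparison)
    have "norm (sqrt_iter X k (sqrt_iter X k x - ?Y x)) \<le> norm (sqrt_iter X k x - ?Y x)" for k
      using norm_sqrt_iter[of k "sqrt_iter X k x - ?Y x"] sqrt_bound_range[of k]
        mult_right_mono[of "sqrt_bound k" 1 "norm (sqrt_iter X k x - ?Y x)"] by simp
    thus "\<forall>\<^sub>F k in sequentially. norm (sqrt_iter X k (sqrt_iter X k x - ?Y x))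
        \<le> norm (sqrt_iter X k x - ?Y x)" by simp
    show "(\<lambda>k. norm (sqrt_iter X k x - ?Y x)) \<longlonglongrightarrow> 0"
      using tendsto_norm[OF LIM_zero[OF sqrt_iter_LIMSEQ[of x]]] by simp
  qed
  from tendsto_add[OF this sqrt_iter_LIMSEQ[of "?Y x"]]
  have "(\<lambda>k. sqrt_iter X k (sqrt_iter X k x)) \<longlonglongrightarrow> ?Y (?Y x)"
    by (simp add: bop_diff[OF bop_sqrt_iter[OF X]])
  hence "(\<lambda>k. sqrt_iter X (Suc k) x) \<longlonglongrightarrow> (1/2) *\<^sub>R (X x + ?Y (?Y x))"
    by (auto intro!: tendsto_intros)
  thus ?thesis using LIMSEQ_unique LIMSEQ_Suc[OF sqrt_iter_LIMSEQ[of x]] by blast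
qed

lemma sqrt_lim_sqrt_lim: "sqrt_lim X (sqrt_lim X x) = sqrt_lim X x + sqrt_lim X x - X x"
  using arg_cong[OF sqrt_lim_eq[of x], of "\<lambda>v. 2 *\<^sub>R v"] by (simp add: scaleR_2)

end

lemma sqrt_lim_intertwine:
  fixes X :: "'a::complex_hilbert \<Rightarrow> 'a" and X' :: "'b::complex_hilbert \<Rightarrow> 'b"
  assumes "bop X" "\<And>x. norm (X x) \<le> norm x" "bop X'" "\<And>x. norm (X' x) \<le> norm x"
    and Z: "bop Z" "\<And>x. Z (X x) = X' (Z x)"
  shows "Z (sqrt_lim X x) = sqrt_lim X' (Z x)"
proof (rule LIMSEQ_unique)
  show "(\<lambda>k. sqrt_iter X' k (Z x)) \<longlonglongrightarrow> Z (sqrt_lim X x)"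
    using bop_tendsto[OF Z(1) sqrt_iter_LIMSEQ[OF assms(1,2)], of x]
    by (simp add: sqrt_iter_intertwine[of Z X X', OF Z])
  show "(\<lambda>k. sqrt_iter X' k (Z x)) \<longlonglongrightarrow> sqrt_lim X' (Z x)"
    by (rule sqrt_iter_LIMSEQ[OF assms(3,4)])
qed

text \<open>\<open>1 - Y\<close> is positive because \<open>Y\<close> is symmetric of norm at most
  1. For uniqueness, a positive root \<open>R\<close> commutes with its square, hence with
  \<open>X\<close> and with \<open>D\<close>, so \<open>(D + R) (D - R) = 0\<close>.\<close>

lemma sqrt_op_eq:
  fixes X :: "'a::complex_hilbert \<Rightarrow> 'a"
  assumes X: "bop X" "\<And>x. norm (X x) \<le> norm x" and sym: "\<And>x y. inner (X x) y = inner x (X y)"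
  shows "sqrt_op (\<lambda>x. x - X x) = (\<lambda>x. x - sqrt_lim X x)"
    and "positive_op (\<lambda>x. x - sqrt_lim X x)"
proof -
  let ?Y = "sqrt_lim X"
  define D where "D = (\<lambda>x. x - ?Y x)"
  have Y: "bop ?Y" by (rule bop_sqrt_lim[OF X])
  have D: "bop D" unfolding D_def by (intro bop_sub bop_ident Y)
  have Ysym: "inner (?Y x) y = inner x (?Y y)" for x y
  proof (rule LIMSEQ_unique)
    show "(\<lambda>k. inner (sqrt_iter X k x) y) \<longlonglongrightarrow> inner (?Y x) y"
      by (intro tendsto_inner sqrt_iter_LIMSEQ[OF X] tendsto_const)
    show "(\<lambda>k. inner (sqrt_iter X k x) y) \<longlonglongrightarrow> inner x (?Y y)"
      unfolding sqrt_iter_symmetric[of X, OF sym]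
      by (intro tendsto_inner sqrt_iter_LIMSEQ[OF X] tendsto_const)
  qed
  have Dsym: "inner (D x) y = inner x (D y)" for x y
    by (simp add: D_def inner_diff_left inner_diff_right Ysym)
  have Dnn: "0 \<le> inner (D x) x" for x
  proof -
    have "inner (?Y x) x \<le> norm (?Y x) * norm x" by (rule norm_cauchy_schwarz)
    also have "\<dots> \<le> norm x * norm x"
      by (intro mult_right_mono norm_sqrt_lim[OF X] norm_ge_zero)
    finally show ?thesis
      by (simp add: D_def inner_diff_left power2_norm_eq_inner[symmetric] power2_eq_square)
  qed
  have "cinner (D x) x = cnj (cinner (D x) x)" for x
    by (rule trans[OF cinner_commute]) (simp only: cinner_eq_if_inner_eq[OF D Dsym, of x x])
  hence "Im (cinner (D x) x) = 0" for x
    by (simp add: complex_eq_iff)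
  hence Dpos: "positive_op D"
    unfolding positive_op_def using D Dnn by (simp add: complex_nonneg_Reals_iff Re_cinner)
  have DD: "D (D x) = x - X x" for x
    by (simp add: D_def bop_diff[OF Y] sqrt_lim_sqrt_lim[OF X])
  have uniq: "R = D" if R: "positive_op R" "R \<circ> R = (\<lambda>x. x - X x)" for R
  proof
    fix x
    have RR: "R (R x) = x - X x" for x using fun_cong[OF R(2)] by simp
    have bR: "bop R" using R by (simp add: positive_op_def)
    have "R (X x) = X (R x)" for x
      using arg_cong[OF RR[of x], of R] RR[of "R x"] by (simp add: bop_diff[OF bR])
    hence RD: "R (D x) = D (R x)" for x
      unfolding D_def bop_diff[OF bR] using sqrt_lim_intertwine[OF X X bR, of x] by simp
    \<comment> \<open>Both quadratic forms are nonnegative at \<open>y\<close> and add up to 0, so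
      \<open>D\<close> and \<open>R\<close> kill \<open>y\<close>; symmetry then gives
      \<open>inner y y = 0\<close>.\<close>
    define y where "y = D x - R x"
    have "D y + R y = 0"
      by (simp add: y_def bop_diff[OF bR] bop_diff[OF D] DD RR RD)
    hence "inner (D y) y + inner (R y) y = 0" by (metis inner_add_left inner_zero_left)
    hence "inner (D y) y = 0" "inner (R y) y = 0"
      using positive_op_nonneg[OF Dpos, of y] positive_op_nonneg[OF R(1), of y] by linarith+
    hence "D y = 0" "R y = 0"
      using positive_op_kernel Dpos R(1) by blast+
    moreover have "inner y y = inner x (D y) - inner x (R y)"
      by (subst (1) y_def) (simp add: inner_diff_left Dsym positive_op_symmetric[OF R(1)])
    ultimately show "R x = D x" by (simp add: y_def)
  qed
  show "positive_op (\<lambda>x. x - sqrt_lim X x)" using Dpos by (simp add: D_def)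
  have "D \<circ> D = (\<lambda>x. x - X x)" by (simp add: fun_eq_iff DD)
  hence "sqrt_op (\<lambda>x. x - X x) = D"
    unfolding sqrt_op_def using Dpos uniq by (intro the_equality) blast+
  thus "sqrt_op (\<lambda>x. x - X x) = (\<lambda>x. x - sqrt_lim X x)" by (simp only: D_def)
qed

section \<open>Contractions and their defect operators\<close>

definition contractive :: "('a::complex_inner \<Rightarrow> 'a) \<Rightarrow> bool"
  where "contractive P \<longleftrightarrow> bop P \<and> (\<forall>x. norm (P x) \<le> norm x)"

lemma contractive_bop: "contractive P \<Longrightarrow> bop P"
  and contractive_le: "contractive P \<Longrightarrow> norm (P x) \<le> norm x"
  by (auto simp: contractive_def)

lemma contractive_adj:
  fixes P :: "'a::complex_hilbert \<Rightarrow> 'a"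
  shows "contractive P \<Longrightarrow> contractive (adj P)"
  using norm_adj_le[of P 1] by (simp add: contractive_def bop_adj)

lemma inner_funpow_adj:
  fixes T :: "'a::complex_hilbert \<Rightarrow> 'a"
  assumes "bop T"
  shows "inner ((T ^^ k) x) y = inner x ((adj T ^^ k) y)"
  by (induction k arbitrary: y) (simp_all add: inner_adj[OF assms] funpow_swap1[of "adj T"])

context
  fixes P :: "'a::complex_hilbert \<Rightarrow> 'a"
  assumes P: "contractive P"
begin

lemma bop_adj_self: "bop (\<lambda>x. adj P (P x))"
  using P by (simp add: contractive_bop bop_compose bop_adj)

lemma adj_self_le: "norm (adj P (P x)) \<le> norm x"
  using contractive_le[OF contractive_adj[OF P], of "P x"] contractive_le[OF P, of x] by linarith

lemma adj_self_symmetric: "inner (adj P (P x)) y = inner x (adj P (P y))"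
  by (simp add: inner_adj'[OF contractive_bop[OF P]] inner_adj[OF contractive_bop[OF P]])

lemma defect_op_eq: "defect_op P = (\<lambda>x. x - sqrt_lim (\<lambda>x. adj P (P x)) x)"
  unfolding defect_op_def by (rule sqrt_op_eq[OF bop_adj_self adj_self_le adj_self_symmetric])

lemma positive_defect_op: "positive_op (defect_op P)"
  unfolding defect_op_eq by (rule sqrt_op_eq[OF bop_adj_self adj_self_le adj_self_symmetric])

lemma bop_defect_op: "bop (defect_op P)"
  using positive_defect_op by (simp add: positive_op_def)

lemma defect_op_symmetric: "inner (defect_op P x) y = inner x (defect_op P y)"
  by (rule positive_op_symmetric[OF positive_defect_op])

lemma defect_op_defect_op: "defect_op P (defect_op P x) = x - adj P (P x)"
  by (simp add: defect_op_eq bop_diff[OF bop_sqrt_lim[OF bop_adj_self adj_self_le]]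
      sqrt_lim_sqrt_lim[OF bop_adj_self adj_self_le])

lemma inner_contraction: "inner (P x) (P y) = inner x y - inner (defect_op P x) (defect_op P y)"
  by (simp add: defect_op_symmetric
      defect_op_defect_op inner_diff_right inner_adj[OF contractive_bop[OF P]])

lemma subspace_defect_space: "subspace (defect_space P)"
  unfolding defect_space_def
  by (rule subspace_closure, rule linear_subspace_image)
    (rule bounded_linear.linear[OF bop_bounded_linear[OF bop_defect_op]], rule subspace_UNIV)

lemma defect_op_in_defect_space: "defect_op P x \<in> defect_space P"
  unfolding defect_space_def by (rule subsetD[OF closure_subset rangeI])

text \<open>Continuity reduces a claim on the whole defect space to the range of the defect
  operator. The case \<open>M = {0}\<close> shows that an operator vanishes there.\<close>

lemma bop_maps_defect_space:
  assumes "bop T" "closed M" "\<And>x. T (defect_op P x) \<in> M" "x \<in> defect_space P"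
  shows "T x \<in> M"
proof -
  have "T ` closure (range (defect_op P)) \<subseteq> M"
    using assms(3) by (intro image_closure_subset bop_continuous assms(1,2)) auto
  with assms(4) show ?thesis by (auto simp: defect_space_def)
qed

lemma scaleC_in_defect_space: "x \<in> defect_space P \<Longrightarrow> c *\<^sub>C x \<in> defect_space P"
proof (rule bop_maps_defect_space[of "\<lambda>x. c *\<^sub>C x"])
  show "bop (\<lambda>x::'a. c *\<^sub>C x)"
    by (simp add: bop_iff bounded_linear_scaleC scaleC_scaleC mult.commute)
  show "closed (defect_space P)" by (simp add: defect_space_def)
  show "c *\<^sub>C defect_op P x \<in> defect_space P" for x
    using defect_op_in_defect_space[of "c *\<^sub>C x"] by (simp add: bop_scaleC[OF bop_defect_op])
qed

text \<open>By symmetry the kernel of the defect operator is orthogonal to its range, hence to the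
  closure. Cancelling a defect operator on the left rests on this.\<close>

lemma defect_op_injective:
  assumes "x \<in> defect_space P" "defect_op P x = 0"
  shows "x = 0"
proof -
  have "inner x (defect_op P y) = 0" for y
    using defect_op_symmetric[of x y] assms(2) by simp
  moreover have "closed {y. inner x y = 0}" by (intro closed_Collect_eq continuous_intros)
  ultimately have "closure (range (defect_op P)) \<subseteq> {y. inner x y = 0}"
    by (intro closure_minimal) auto
  hence "inner x x = 0" using assms(1) unfolding defect_space_def by blast
  thus ?thesis by simp
qed

end

text \<open>A relation between \<open>adj P \<circ> P\<close> and \<open>adj P' \<circ> P'\<close>
  passes to the square roots. With \<open>Z = P\<close> it yields
  \<open>contraction_defect_op\<close>; a unitary \<open>Z\<close> carries defect operators to
  defect operators.\<close>

lemma defect_op_intertwine: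
  fixes P :: "'a::complex_hilbert \<Rightarrow> 'a" and P' :: "'b::complex_hilbert \<Rightarrow> 'b"
  assumes P: "contractive P" and P': "contractive P'"
    and Z: "bop Z" "\<And>x. Z (adj P (P x)) = adj P' (P' (Z x))"
  shows "Z (defect_op P x) = defect_op P' (Z x)"
  using sqrt_lim_intertwine[OF bop_adj_self[OF P] adj_self_le[OF P] bop_adj_self[OF P']
      adj_self_le[OF P'] Z]
  by (simp add: defect_op_eq[OF P] defect_op_eq[OF P'] bop_diff[OF Z(1)])

lemma contraction_defect_op:
  fixes P :: "'a::complex_hilbert \<Rightarrow> 'a"
  assumes P: "contractive P"
  shows "P (defect_op P x) = defect_op (adj P) (P x)"
  by (rule defect_op_intertwine[OF P contractive_adj[OF P] contractive_bop[OF P]])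
    (simp add: adj_adj[OF contractive_bop[OF P]])

lemma contraction_in_defect_space:
  fixes P :: "'a::complex_hilbert \<Rightarrow> 'a"
  assumes P: "contractive P" and x: "x \<in> defect_space P"
  shows "P x \<in> defect_space (adj P)"
  by (rule bop_maps_defect_space[OF P contractive_bop[OF P] _ _ x])
    (simp_all add: contraction_defect_op[OF P] defect_op_in_defect_space[OF contractive_adj[OF P]],
      simp add: defect_space_def)

lemma defect_op_adj_defect_op_adj:
  fixes P :: "'a::complex_hilbert \<Rightarrow> 'a"
  assumes P: "contractive P"
  shows "defect_op (adj P) (defect_op (adj P) x) = x - P (adj P x)"
  using defect_op_defect_op[OF contractive_adj[OF P], of x]
  by (simp add: adj_adj[OF contractive_bop[OF P]])

text \<open>The vectors satisfying all these equations form a closed reducing subspace on which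
  \<open>P\<close> and \<open>adj P\<close> are inverse to each other, so \<open>P\<close> is
  unitary there. This is the form in which complete non-unitarity yields spanning vectors.\<close>

lemma cnu_trivial:
  fixes P :: "'a::complex_hilbert \<Rightarrow> 'a"
  assumes P: "contractive P" and "cnu P"
    and x: "\<And>k. defect_op P ((P ^^ k) x) = 0" "\<And>k. defect_op (adj P) ((adj P ^^ k) x) = 0"
  shows "x = 0"
proof -
  note bP = contractive_bop[OF P] and bD = bop_defect_op[OF P]
  note bA = bop_adj[OF bP] and bE = bop_defect_op[OF contractive_adj[OF P]]
  define M where "M = {x. (\<forall>k. defect_op P ((P ^^ k) x) = 0)
      \<and> (\<forall>k. defect_op (adj P) ((adj P ^^ k) x) = 0)}"
  have PA: "P (adj P y) = y" and AP: "adj P (P y) = y" if "y \<in> M" for y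
  proof -
    have "defect_op P ((P ^^ 0) y) = 0" "defect_op (adj P) ((adj P ^^ 0) y) = 0"
      using that unfolding M_def by blast+
    thus "P (adj P y) = y" "adj P (P y) = y"
      using defect_op_defect_op[OF P, of y] defect_op_adj_defect_op_adj[OF P, of y]
      by (simp_all add: bop_zero[OF bD] bop_zero[OF bE])
  qed
  have PM: "P y \<in> M" if y: "y \<in> M" for y
  proof -
    have "defect_op P ((P ^^ Suc k) y) = 0" for k
      using y unfolding M_def by blast
    hence "defect_op P ((P ^^ k) (P y)) = 0" for k
      by (simp add: funpow_swap1)
    moreover have "defect_op (adj P) ((adj P ^^ k) (P y)) = 0" for k
    proof (cases k)
      \<comment> \<open>For \<open>k = 0\<close> the required value is
        \<open>defect_op (adj P) (P y) = P (defect_op P y)\<close>. For larger \<open>k\<close> one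
        factor cancels, since \<open>adj P (P y) = y\<close>.\<close>
      case 0
      have "defect_op P ((P ^^ 0) y) = 0" using y unfolding M_def by blast
      thus ?thesis using 0 by (simp add: contraction_defect_op[OF P, symmetric] bop_zero[OF bP])
    next
      case (Suc j)
      hence "(adj P ^^ k) (P y) = (adj P ^^ j) y" by (simp add: funpow_swap1 AP[OF y])
      thus ?thesis using y by (simp add: M_def)
    qed
    ultimately show ?thesis by (simp add: M_def)
  qed
  have AM: "adj P y \<in> M" if y: "y \<in> M" for y
  proof -
    have "defect_op (adj P) ((adj P ^^ Suc k) y) = 0" for k
      using y unfolding M_def by blast
    hence "defect_op (adj P) ((adj P ^^ k) (adj P y)) = 0" for k
      by (simp add: funpow_swap1)
    moreover have "defect_op P ((P ^^ k) (adj P y)) = 0" for k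
    proof (cases k)
      case 0
      have "defect_op (adj P) ((adj P ^^ 0) y) = 0" using y unfolding M_def by blast
      thus ?thesis using 0 contraction_defect_op[OF contractive_adj[OF P], of y]
        by (simp add: adj_adj[OF bP] bop_zero[OF bA])
    next
      case (Suc j)
      hence "(P ^^ k) (adj P y) = (P ^^ j) y" by (simp add: funpow_swap1 PA[OF y])
      thus ?thesis using y by (simp add: M_def)
    qed
    ultimately show ?thesis by (simp add: M_def)
  qed
  have bDk: "bop (\<lambda>x. defect_op P ((P ^^ k) x))"
      and bEk: "bop (\<lambda>x. defect_op (adj P) ((adj P ^^ k) x))" for k
    by (rule bop_compose[OF bD bop_funpow[OF bP]], rule bop_compose[OF bE bop_funpow[OF bA]])
  have "csubspace M"
    unfolding csubspace_def M_def
    by (auto simp: bop_zero[OF bDk] bop_zero[OF bEk] bop_add[OF bDk] bop_add[OF bEk]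
        bop_scaleC[OF bDk] bop_scaleC[OF bEk])
  moreover have "closed M"
  proof -
    have "M = (\<Inter>k. {x. defect_op P ((P ^^ k) x) = 0} \<inter> {x. defect_op (adj P) ((adj P ^^ k) x) = 0})"
      by (auto simp: M_def)
    moreover have "closed \<dots>"
      by (intro closed_INT ballI closed_Int closed_Collect_eq continuous_on_const
          bop_continuous[OF bDk] bop_continuous[OF bEk])
    ultimately show ?thesis by simp
  qed
  moreover have "P ` M \<subseteq> M" "adj P ` M \<subseteq> M" using PM AM by auto
  moreover have "unitary_op M M P"
    unfolding unitary_op_def clinear_on_def
  proof (intro conjI ballI allI)
    show "P ` M = M"
    proof
      show "M \<subseteq> P ` M"
      proof
        fix y assume y: "y \<in> M"
        thus "y \<in> P ` M" using PA[OF y] AM[OF y] by (metis image_eqI)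
      qed
    qed (use PM in auto)
    show "P (x + y) = P x + P y" for x y by (rule bop_add[OF bP])
    show "P (c *\<^sub>C x) = c *\<^sub>C P x" for c x by (rule bop_scaleC[OF bP])
    show "cinner (P x) (P y) = cinner x y" if "y \<in> M" for x y
      by (simp add: cinner_adj[OF bP] AP[OF that])
  qed
  ultimately have "M = {0}" using \<open>cnu P\<close> unfolding cnu_def by blast
  thus ?thesis using x by (auto simp: M_def)
qed

section \<open>Taylor coefficients of the characteristic function\<close>

text \<open>Onto because \<open>y = w + z Q y\<close> is a fixed point equation for a strict
  contraction; this makes the \<open>inv\<close> in \<open>char_fun\<close> a genuine
  resolvent.\<close>

lemma bij_one_minus_contraction:
  fixes Q :: "'a::complex_hilbert \<Rightarrow> 'a"
  assumes Q: "contractive Q" and z: "cmod z < 1"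
  shows "bij (\<lambda>y. y - z *\<^sub>C Q y)"
proof (rule bijI)
  have le: "norm (z *\<^sub>C Q y) \<le> cmod z * norm y" for y
    using contractive_le[OF Q, of y] by (simp add: norm_scaleC mult_left_mono)
  show "inj (\<lambda>y. y - z *\<^sub>C Q y)"
  proof (rule injI)
    fix x y assume "x - z *\<^sub>C Q x = y - z *\<^sub>C Q y"
    hence "x - y = z *\<^sub>C Q (x - y)"
      by (simp add: bop_diff[OF contractive_bop[OF Q]] scaleC_diff_right algebra_simps)
    hence "norm (x - y) \<le> cmod z * norm (x - y)" using le[of "x - y"] by simp
    hence "(1 - cmod z) * norm (x - y) \<le> 0" by (simp add: algebra_simps)
    thus "x = y" using z by (simp add: mult_le_0_iff)
  qed
  show "surj (\<lambda>y. y - z *\<^sub>C Q y)"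
  proof (rule surjI)
    fix w
    have "\<exists>!y\<in>UNIV. w + z *\<^sub>C Q y = y"
    proof (rule Banach_fix[of _ "cmod z"])
      show "dist (w + z *\<^sub>C Q x) (w + z *\<^sub>C Q y) \<le> cmod z * dist x y" for x y
        using le[of "x - y"]
        by (simp add: dist_norm bop_diff[OF contractive_bop[OF Q]] scaleC_diff_right)
    qed (use z complete_UNIV in auto)
    then obtain y where "w + z *\<^sub>C Q y = y" by blast
    hence "y - z *\<^sub>C Q y = w" by (simp add: diff_eq_eq)
    hence "\<exists>y. y - z *\<^sub>C Q y = w" by blast
    thus "(SOME y. y - z *\<^sub>C Q y = w) - z *\<^sub>C Q (SOME y. y - z *\<^sub>C Q y = w) = w"
      by (rule someI_ex)
  qed
qed

abbreviation resolvent :: "('a::complex_inner \<Rightarrow> 'a) \<Rightarrow> complex \<Rightarrow> 'a \<Rightarrow> 'a"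
  where "resolvent Q z \<equiv> inv (\<lambda>y. y - z *\<^sub>C Q y)"

text \<open>One step of the Neumann series, with \<open>Q\<close> kept on the right so that
  iteration only changes the vector \<open>w\<close>.\<close>

lemma resolvent_expand:
  fixes Q :: "'a::complex_hilbert \<Rightarrow> 'a"
  assumes Q: "contractive Q" and z: "cmod z < 1"
  shows "resolvent Q z w = w + z *\<^sub>C resolvent Q z (Q w)"
proof -
  note b = bij_one_minus_contraction[OF assms]
  have s: "resolvent Q z y - z *\<^sub>C Q (resolvent Q z y) = y" for y
    using surj_f_inv_f[OF bij_is_surj[OF b], of y] .
  have "(w + z *\<^sub>C resolvent Q z (Q w)) - z *\<^sub>C Q (w + z *\<^sub>C resolvent Q z (Q w))
      = w - z *\<^sub>C Q w + z *\<^sub>C (resolvent Q z (Q w) - z *\<^sub>C Q (resolvent Q z (Q w)))"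
    by (simp add: bop_add[OF contractive_bop[OF Q]] bop_scaleC[OF contractive_bop[OF Q]]
        scaleC_diff_right scaleC_add_right)
  also have "\<dots> = w" by (simp add: s)
  finally show ?thesis by (metis bij_inv_eq_iff[OF b])
qed

text \<open>A bound uniform near \<open>z = 0\<close>; the radius \<open>1 / 2\<close> is an
  arbitrary choice and gives \<open>1 / (1 - 1 / 2) = 2\<close>.\<close>

lemma norm_resolvent:
  fixes Q :: "'a::complex_hilbert \<Rightarrow> 'a"
  assumes Q: "contractive Q" and z: "cmod z \<le> 1 / 2"
  shows "norm (resolvent Q z w) \<le> 2 * norm w"
proof -
  define y where "y = resolvent Q z w"
  have z1: "cmod z < 1" using z by simp
  have "y - z *\<^sub>C Q y = w"
    unfolding y_def using surj_f_inv_f[OF bij_is_surj[OF bij_one_minus_contraction[OF Q z1]]] .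
  hence "norm y \<le> norm w + norm (z *\<^sub>C Q y)"
    using norm_triangle_ineq[of w "z *\<^sub>C Q y"] by (simp add: diff_eq_eq)
  also have "norm (z *\<^sub>C Q y) \<le> 1 / 2 * norm y"
    unfolding norm_scaleC by (intro mult_mono z contractive_le[OF Q]) auto
  finally show ?thesis by (simp add: y_def)
qed

lemma resolvent_tendsto:
  fixes Q :: "'a::complex_hilbert \<Rightarrow> 'a"
  assumes Q: "contractive Q"
  shows "((\<lambda>z. resolvent Q z w) \<longlongrightarrow> w) (at 0)"
proof -
  have ev: "\<forall>\<^sub>F z in at 0. cmod z < 1 / 2"
    using eventually_at_ball[of "1/2" "0::complex" UNIV] by (simp add: dist_norm)
  have "((\<lambda>z. resolvent Q z w - w) \<longlongrightarrow> 0) (at 0)"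
  proof (rule Lim_null_comparison)
    show "\<forall>\<^sub>F z in at 0. norm (resolvent Q z w - w) \<le> cmod z * (2 * norm (Q w))"
      using ev
    proof eventually_elim
      case (elim z)
      have "resolvent Q z w - w = z *\<^sub>C resolvent Q z (Q w)"
        using resolvent_expand[OF Q, of z w] elim by simp
      thus ?case using norm_resolvent[OF Q, of z "Q w"] elim
        by (simp add: norm_scaleC mult_left_mono)
    qed
    have "((\<lambda>z. cmod z * (2 * norm (Q w))) \<longlongrightarrow> cmod 0 * (2 * norm (Q w))) (at 0)"
      by (intro tendsto_intros)
    thus "((\<lambda>z. cmod z * (2 * norm (Q w))) \<longlongrightarrow> 0) (at 0)" by simp
  qed
  thus ?thesis by (simp add: LIM_zero_iff)
qed

text \<open>Comparing limits at \<open>z = 0\<close> and dividing by \<open>z\<close> peels off one Neumann coefficient at a time.\<close>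

lemma resolvent_coefficients:
  fixes Q :: "'a::complex_hilbert \<Rightarrow> 'a" and Q' :: "'b::complex_hilbert \<Rightarrow> 'b"
    and T :: "'a \<Rightarrow> 'c::complex_hilbert"
  assumes Q: "contractive Q" and Q': "contractive Q'" and T: "bop T" and T': "bop T'"
    and eq: "\<And>z. cmod z < 1 \<Longrightarrow> z \<noteq> 0 \<Longrightarrow> T (resolvent Q z w) = T' (resolvent Q' z w')"
  shows "T ((Q ^^ k) w) = T' ((Q' ^^ k) w')"
proof -
  \<comment> \<open>Stated for arbitrary vectors, to be reused at \<open>(Q ^^ k) w\<close>. The
    point 0 is excluded because each division by \<open>z\<close> loses it; the limit recovers its
    value.\<close>
  have lim: "T w = T' w'"
    if eq: "\<And>z. cmod z < 1 \<Longrightarrow> z \<noteq> 0 \<Longrightarrow> T (resolvent Q z w) = T' (resolvent Q' z w')" for w w'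
  proof (rule tendsto_unique)
    show "((\<lambda>z. T (resolvent Q z w)) \<longlongrightarrow> T w) (at 0)"
      by (rule bop_tendsto[OF T resolvent_tendsto[OF Q]])
    have ev: "\<forall>\<^sub>F z in at 0. T' (resolvent Q' z w') = T (resolvent Q z w)"
      using eventually_at_ball'[of 1 "0::complex" UNIV]
      by (rule eventually_mono) (use eq in \<open>auto simp: dist_norm\<close>)
    show "((\<lambda>z. T (resolvent Q z w)) \<longlongrightarrow> T' w') (at 0)"
      by (rule Lim_transform_eventually[OF bop_tendsto[OF T' resolvent_tendsto[OF Q']] ev])
  qed simp
  have "\<forall>z. cmod z < 1 \<longrightarrow> z \<noteq> 0 \<longrightarrow>
      T (resolvent Q z ((Q ^^ k) w)) = T' (resolvent Q' z ((Q' ^^ k) w'))"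
  proof (induction k)
    case 0
    show ?case using eq by simp
  next
    case (Suc k)
    show ?case
    proof (intro allI impI)
      fix z :: complex assume z: "cmod z < 1" "z \<noteq> 0"
      have "T (resolvent Q z ((Q ^^ k) w)) = T' (resolvent Q' z ((Q' ^^ k) w'))"
        using Suc z by blast
      hence "T ((Q ^^ k) w) + z *\<^sub>C T (resolvent Q z (Q ((Q ^^ k) w)))
          = T' ((Q' ^^ k) w') + z *\<^sub>C T' (resolvent Q' z (Q' ((Q' ^^ k) w')))"
        unfolding resolvent_expand[OF Q z(1), of "(Q ^^ k) w"]
            resolvent_expand[OF Q' z(1), of "(Q' ^^ k) w'"]
        by (simp only: bop_add[OF T] bop_add[OF T'] bop_scaleC[OF T] bop_scaleC[OF T'])
      moreover have "T ((Q ^^ k) w) = T' ((Q' ^^ k) w')" by (rule lim) (use Suc in blast)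
      ultimately have "inverse z *\<^sub>C z *\<^sub>C T (resolvent Q z (Q ((Q ^^ k) w)))
          = inverse z *\<^sub>C z *\<^sub>C T' (resolvent Q' z (Q' ((Q' ^^ k) w')))" by simp
      thus "T (resolvent Q z ((Q ^^ Suc k) w)) = T' (resolvent Q' z ((Q' ^^ Suc k) w'))"
        using z by (simp add: scaleC_scaleC)
    qed
  qed
  thus ?thesis by - (rule lim, blast)
qed

section \<open>Unitary operators with prescribed values\<close>

lemma closure_span_invariant:
  assumes F: "bounded_linear F" and G: "\<And>x. x \<in> G \<Longrightarrow> F x \<in> closure (span G)"
    and x: "x \<in> closure (span G)"
  shows "F x \<in> closure (span G)"
proof -
  have "F y \<in> closure (span G)" if "y \<in> span G" for y
    using that
  proof (induction rule: span_induct)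
    case base
    show ?case
      unfolding mem_Collect_eq
      using linear_subspace_vimage[OF bounded_linear.linear[OF F]
          subspace_closure[OF subspace_span[of G]]]
      by (simp add: vimage_def)
  qed (rule G)
  hence "F ` closure (span G) \<subseteq> closure (span G)"
    by (intro image_closure_subset linear_continuous_on F closed_closure) auto
  thus ?thesis using x by blast
qed

text \<open>The closed span \<open>V\<close> of the pairs is itself the graph of \<open>U\<close>.
  Equal Gram matrices make both coordinates of each pair in \<open>V\<close> equally long, which
  gives single-valuedness and the isometry; no map on linear combinations has to be shown well
  defined.\<close>

lemma isometry_of_equal_gram:
  fixes G :: "('a::{real_inner,complete_space} \<times> 'b::{real_inner,complete_space}) set"
  assumes gram: "\<And>p q. p \<in> G \<Longrightarrow> q \<in> G \<Longrightarrow> inner (fst p) (fst q) = inner (snd p) (snd q)"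
    and dense: "closure (span (fst ` G)) = UNIV" "closure (span (snd ` G)) = UNIV"
  obtains U where "bounded_linear U" "surj U" "\<And>x. norm (U x) = norm x"
    "\<And>p. p \<in> closure (span G) \<longleftrightarrow> snd p = U (fst p)"
proof -
  define V where "V = closure (span G)"
  have V: "subspace V" unfolding V_def by (rule subspace_closure[OF subspace_span])
  have "inner (fst p) (fst q) = inner (snd p) (snd q)" if p: "p \<in> span G" and q: "q \<in> span G" for p q
    using p
  proof (induction rule: span_induct)
    case base
    show ?case by (auto simp: subspace_def inner_add_left)
  next
    case (step p)
    show ?case using q
    proof (induction rule: span_induct)
      case base
      show ?case by (auto simp: subspace_def inner_add_right)
    qed (use step gram in blast)
  qed
  hence "span G \<subseteq> {p. norm (fst p) = norm (snd p)}"
    by (auto simp: norm_eq_sqrt_inner)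
  moreover have "closed {p::'a \<times> 'b. norm (fst p) = norm (snd p)}"
    by (intro closed_Collect_eq continuous_intros)
  ultimately have norm_eq: "norm (fst p) = norm (snd p)" if "p \<in> V" for p
    using that closure_minimal unfolding V_def by blast
  have "complete V" unfolding V_def by (simp add: complete_eq_closed)
  \<comment> \<open>A map bounded below on the complete space \<open>V\<close> has a closed image,
    and this image contains a dense span.\<close>
  have proj: "f ` V = UNIV"
    if f: "bounded_linear f" and d: "closure (span (f ` G)) = UNIV"
      and fn: "\<And>p. p \<in> V \<Longrightarrow> norm p \<le> 2 * norm (f p)"
    for f :: "'a \<times> 'b \<Rightarrow> 'c::{real_inner,complete_space}"
  proof -
    have "closed (f ` V)"
      by (intro complete_imp_closed complete_isometric_image[of "1/2"] V f \<open>complete V\<close>)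
        (use fn in force)+
    moreover have "span (f ` G) \<subseteq> f ` V"
    proof (rule span_minimal)
      show "f ` G \<subseteq> f ` V"
        unfolding V_def by (rule image_mono) (meson closure_subset span_superset subset_trans)
      show "subspace (f ` V)" by (rule linear_subspace_image[OF bounded_linear.linear[OF f] V])
    qed
    ultimately have "closure (span (f ` G)) \<subseteq> f ` V" by (rule closure_minimal[rotated])
    thus ?thesis using d by blast
  qed
  \<comment> \<open>The factor 2 comes from \<open>norm p \<le> norm (fst p) + norm (snd p)\<close>
    with equal summands.\<close>
  have np: "norm p \<le> 2 * norm (fst p)" "norm p \<le> 2 * norm (snd p)" if "p \<in> V" for p
    using norm_Pair_le[of "fst p" "snd p"] norm_eq[OF that] by simp_all
  have surj_fst: "fst ` V = UNIV"
    by (rule proj[OF bounded_linear_fst dense(1) np(1)])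
  have surj_snd: "snd ` V = UNIV"
    by (rule proj[OF bounded_linear_snd dense(2) np(2)])
  have single_valued: "snd p = snd q" if "p \<in> V" "q \<in> V" "fst p = fst q" for p q
    using norm_eq[OF subspace_diff[OF V that(1,2)]] that(3) by simp
  define U where "U x = snd (SOME p. p \<in> V \<and> fst p = x)" for x
  have U: "\<exists>p. p \<in> V \<and> fst p = x \<and> snd p = U x" for x
  proof -
    have "\<exists>p. p \<in> V \<and> fst p = x" using surj_fst by (metis UNIV_I imageE)
    from someI_ex[OF this] show ?thesis unfolding U_def by blast
  qed
  have UV: "p \<in> V \<longleftrightarrow> snd p = U (fst p)" for p
    using U[of "fst p"] single_valued by (metis prod.collapse)
  have "bounded_linear U"
  proof (rule bounded_linear_intro[where K = 1])
    show "U (x + y) = U x + U y" for x y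
      using subspace_add[OF V, of "(x, U x)" "(y, U y)"] by (simp add: UV)
    show "U (r *\<^sub>R x) = r *\<^sub>R U x" for r x
      using subspace_scale[OF V, of "(x, U x)" r] by (simp add: UV)
    show "norm (U x) \<le> norm x * 1" for x
      using norm_eq[of "(x, U x)"] by (simp add: UV)
  qed
  moreover have "surj U"
    using surj_snd UV by (metis (no_types, lifting) surjI imageE surj_def UNIV_I)
  moreover have "norm (U x) = norm x" for x
    using norm_eq[of "(x, U x)"] by (simp add: UV)
  ultimately show thesis using that UV unfolding V_def by blast
qed

section \<open>Coincidence of characteristic functions\<close>

lemma unitary_op_in: "unitary_op M N U \<Longrightarrow> x \<in> M \<Longrightarrow> U x \<in> N"
  and unitary_op_inner: "unitary_op M N U \<Longrightarrow> x \<in> M \<Longrightarrow> y \<in> M \<Longrightarrow> inner (U x) (U y) = inner x y"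
  and unitary_op_add: "unitary_op M N U \<Longrightarrow> x \<in> M \<Longrightarrow> y \<in> M \<Longrightarrow> U (x + y) = U x + U y"
  and unitary_op_scaleC: "unitary_op M N U \<Longrightarrow> x \<in> M \<Longrightarrow> U (c *\<^sub>C x) = c *\<^sub>C U x"
  by (auto simp: unitary_op_def clinear_on_def simp flip: Re_cinner)

lemma unitary_op_norm: "unitary_op M N U \<Longrightarrow> x \<in> M \<Longrightarrow> norm (U x) = norm x"
  by (simp add: norm_eq_sqrt_inner unitary_op_inner)

lemma unitary_op_bop:
  assumes "unitary_op UNIV N U"
  shows "bop U"
  using assms unitary_op_norm[OF assms]
  by (auto simp: bounded_op_def unitary_op_def intro!: exI[of _ 1])

lemma unitary_op_bop_compose:
  assumes v: "unitary_op M N v" and T: "bop T" "\<And>x. T x \<in> M"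
  shows "bop (\<lambda>x. v (T x))"
proof -
  obtain K where "\<And>x. norm (T x) \<le> K * norm x" using T(1) unfolding bounded_op_def by blast
  thus ?thesis
    unfolding bounded_op_def clinear_on_def
    by (auto simp: bop_add[OF T(1)] bop_scaleC[OF T(1)] unitary_op_add[OF v] unitary_op_scaleC[OF v]
        unitary_op_norm[OF v] T(2))
qed

text \<open>The difference of the two sides lies in \<open>M'\<close>, the image of
  \<open>u\<close>, and is orthogonal to every \<open>u g\<close>. Membership in the subspaces is
  required because \<open>u\<close> and \<open>v\<close> mean nothing outside them.\<close>

lemma unitary_intertwine_adjoint:
  assumes u: "unitary_op M M' u" and v: "unitary_op N N' v" and M': "subspace M'"
    and T: "\<And>x. x \<in> M \<Longrightarrow> T x \<in> N" "\<And>x y. inner (T x) y = inner x (R y)" "R f \<in> M"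
    and T': "\<And>x y. inner (T' x) y = inner x (R' y)" "R' (v f) \<in> M'"
    and eq: "\<And>x. x \<in> M \<Longrightarrow> v (T x) = T' (u x)" and f: "f \<in> N"
  shows "u (R f) = R' (v f)"
proof -
  let ?d = "u (R f) - R' (v f)"
  have *: "inner (u g) ?d = 0" if g: "g \<in> M" for g
    using unitary_op_inner[OF u g T(3)] unitary_op_inner[OF v T(1)[OF g] f] T(2)[of g f]
      T'(1)[of "u g" "v f"] eq[OF g]
    by (simp add: inner_diff_right)
  have "?d \<in> M'" using unitary_op_in[OF u T(3)] T'(2) M' by (simp add: subspace_diff)
  moreover have "u ` M = M'" using u by (simp add: unitary_op_def)
  ultimately obtain g where "g \<in> M" "u g = ?d" by (metis imageE)
  with * have "inner ?d ?d = 0" by metis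
  thus ?thesis by simp
qed

lemma unitary_op_adj:
  fixes T :: "'a::complex_hilbert \<Rightarrow> 'a" and T' :: "'b::complex_hilbert \<Rightarrow> 'b"
  assumes U: "unitary_op UNIV UNIV U" and "bop T" "bop T'" and "\<And>x. U (T x) = T' (U x)"
  shows "U (adj T x) = adj T' (U x)"
  by (rule unitary_intertwine_adjoint[OF U U, of T "adj T" x T' "adj T'"])
    (simp_all add: assms inner_adj)

text \<open>A coincidence at the level of Taylor coefficients: with index \<open>k\<close>,
  \<open>higher_coefficient\<close> concerns the power \<open>z^(k+1)\<close>. Free of
  \<open>z\<close>, this form can be dualized by taking adjoints.\<close>

locale coefficient_coincidence =
  fixes P :: "'a::complex_hilbert \<Rightarrow> 'a" and P' :: "'b::complex_hilbert \<Rightarrow> 'b"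
    and u v :: "'a \<Rightarrow> 'b"
  assumes P: "contractive P" and P': "contractive P'"
    and u: "unitary_op (defect_space P) (defect_space P') u"
    and v: "unitary_op (defect_space (adj P)) (defect_space (adj P')) v"
    and constant_coefficient: "\<And>x. x \<in> defect_space P \<Longrightarrow> v (P x) = P' (u x)"
    and higher_coefficient: "\<And>x k. x \<in> defect_space P \<Longrightarrow>
      v (defect_op (adj P) ((adj P ^^ k) (defect_op P x)))
        = defect_op (adj P') ((adj P' ^^ k) (defect_op P' (u x)))"
begin

lemmas bops = contractive_bop[OF P] contractive_bop[OF P'] bop_adj[OF contractive_bop[OF P]]
  bop_adj[OF contractive_bop[OF P']] 

lemma adj_adj_simps: "adj (adj P) = P" "adj (adj P') = P'"
  by (simp_all add: adj_adj bops)

text \<open>The adjoint of \<open>defect_op (adj P) \<circ> (adj P ^^ k) \<circ> defect_op P\<close>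
  is \<open>defect_op P \<circ> (P ^^ k) \<circ> defect_op (adj P)\<close>. Every result of the
  locale is therefore also available with \<open>P\<close> and \<open>adj P\<close>,
  \<open>u\<close> and \<open>v\<close> exchanged.\<close>

lemma dual: "coefficient_coincidence (adj P) (adj P') v u"
proof
  show "contractive (adj P)" "contractive (adj P')" by (simp_all add: contractive_adj P P')
  show "unitary_op (defect_space (adj (adj P))) (defect_space (adj (adj P'))) u"
    by (simp add: adj_adj_simps u)
  show "unitary_op (defect_space (adj P)) (defect_space (adj P')) v" by (rule v)
  fix f assume f: "f \<in> defect_space (adj P)"
  hence vf: "v f \<in> defect_space (adj P')" by (rule unitary_op_in[OF v])
  note in_adj = contraction_in_defect_space[OF contractive_adj, unfolded adj_adj_simps]
  show "u (adj P f) = adj P' (v f)"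
    by (rule unitary_intertwine_adjoint[OF u v subspace_defect_space[OF P'], of P _ _ P'])
      (use in_adj[OF P f] in_adj[OF P' vf] contraction_in_defect_space[OF P] f
        in \<open>simp_all add: inner_adj bops adj_adj_simps constant_coefficient\<close>)
  show "u (defect_op (adj (adj P)) ((adj (adj P) ^^ k) (defect_op (adj P) f)))
      = defect_op (adj (adj P')) ((adj (adj P') ^^ k) (defect_op (adj P') (v f)))" for k
    unfolding adj_adj_simps
    by (rule unitary_intertwine_adjoint[OF u v subspace_defect_space[OF P'],
          of "\<lambda>x. defect_op (adj P) ((adj P ^^ k) (defect_op P x))"
            "\<lambda>f. defect_op P ((P ^^ k) (defect_op (adj P) f))" _
            "\<lambda>x. defect_op (adj P') ((adj P' ^^ k) (defect_op P' x))"])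
      (use f in \<open>simp_all add: inner_funpow_adj bops adj_adj_simps higher_coefficient
        defect_op_symmetric P P' contractive_adj defect_op_in_defect_space\<close>)
qed

section \<open>Gram matrix of the generators\<close>

lemma gram_power_power:
  assumes f: "f \<in> defect_space (adj P)" and g: "g \<in> defect_space (adj P)"
  shows "inner ((P ^^ m) (defect_op (adj P) f)) ((P ^^ k) (defect_op (adj P) g))
    = inner ((P' ^^ m) (defect_op (adj P') (v f))) ((P' ^^ k) (defect_op (adj P') (v g)))"
proof -
  note dual_const = coefficient_coincidence.constant_coefficient[OF dual]
    and dual_higher = coefficient_coincidence.higher_coefficient[OF dual, unfolded adj_adj_simps]
  note D = defect_op_in_defect_space[OF P]
      and Pin = contraction_in_defect_space[OF contractive_adj[OF P], unfolded adj_adj_simps]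
  \<comment> \<open>For \<open>k = 0\<close> the squared defect operator is \<open>1 - P P*\<close>,
    leaving products of \<open>f, g\<close> and of \<open>P* f, P* g\<close>, which \<open>v\<close>
    and \<open>u\<close> preserve. For \<open>k = j + 1\<close> one factor \<open>P\<close> is moved
    past the defect operator and over to \<open>f\<close>, and a dual coefficient remains.\<close>
  have first: "inner (defect_op (adj P) f) ((P ^^ k) (defect_op (adj P) g))
    = inner (defect_op (adj P') (v f)) ((P' ^^ k) (defect_op (adj P') (v g)))"
    if f: "f \<in> defect_space (adj P)" and g: "g \<in> defect_space (adj P)" for f g k
  proof (cases k)
    case 0
    have "inner f g - inner (adj P f) (adj P g)
        = inner (v f) (v g) - inner (adj P' (v f)) (adj P' (v g))"
      using unitary_op_inner[OF v f g] unitary_op_inner[OF u Pin[OF f] Pin[OF g]]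
      by (simp add: dual_const f g)
    thus ?thesis using 0
      by (simp add: defect_op_symmetric contractive_adj P P' defect_op_adj_defect_op_adj
          inner_diff_right inner_adj'[OF contractive_bop])
  next
    case (Suc j)
    have "inner (adj P f) (defect_op P ((P ^^ j) (defect_op (adj P) g)))
        = inner (adj P' (v f)) (defect_op P' ((P' ^^ j) (defect_op (adj P') (v g))))"
      using unitary_op_inner[OF u Pin[OF f] D[of "(P ^^ j) (defect_op (adj P) g)"]]
      by (simp add: dual_const dual_higher f g)
    thus ?thesis using Suc
      by (simp add: defect_op_symmetric contractive_adj P P' contraction_defect_op[symmetric]
          inner_adj'[OF contractive_bop])
  qed
  \<comment> \<open>Both powers drop by one at the cost of a product of two dual coefficients, which
    \<open>u\<close> preserves; once one power is 0, symmetry reduces to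
    \<open>first\<close>.\<close>
  show ?thesis
  proof (induction m arbitrary: k)
    case 0
    show ?case using first[OF f g] by simp
  next
    case (Suc m)
    show ?case
    proof (cases k)
      case 0
      thus ?thesis using first[OF g f, of "Suc m"] by (simp add: inner_commute)
    next
      case (Suc j)
      have "inner (defect_op P ((P ^^ m) (defect_op (adj P) f))) (defect_op P ((P ^^ j) (defect_op (adj P) g)))
        = inner (defect_op P' ((P' ^^ m) (defect_op (adj P') (v f)))) (defect_op P' ((P' ^^ j) (defect_op (adj P') (v g))))"
        using unitary_op_inner[OF u D[of "(P ^^ m) (defect_op (adj P) f)"]
            D[of "(P ^^ j) (defect_op (adj P) g)"]]
        by (simp add: dual_higher f g)
      thus ?thesis using Suc.IH[of j] Suc by (simp add: inner_contraction P P')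
    qed
  qed
qed

text \<open>All powers and the defect operator of the left factor can be moved to the right, leaving
  the single coefficient with index \<open>m + k\<close>.\<close>

lemma gram_power_adj_power:
  assumes f: "f \<in> defect_space (adj P)" and g: "g \<in> defect_space P"
  shows "inner ((P ^^ m) (defect_op (adj P) f)) ((adj P ^^ k) (defect_op P g))
    = inner ((P' ^^ m) (defect_op (adj P') (v f))) ((adj P' ^^ k) (defect_op P' (u g)))"
proof -
  have "inner f (defect_op (adj P) ((adj P ^^ (m + k)) (defect_op P g)))
    = inner (v f) (defect_op (adj P') ((adj P' ^^ (m + k)) (defect_op P' (u g))))"
    using unitary_op_inner[OF v f defect_op_in_defect_space[OF contractive_adj[OF P]]]
    by (simp add: higher_coefficient g flip: higher_coefficient)
  thus ?thesis
    by (simp add: inner_funpow_adj bops defect_op_symmetric contractive_adj P P' funpow_add)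
qed

text \<open>Each spanning vector is paired with its intended image, so that the closed span of the
  pairs can be taken as the graph of the unitary.\<close>

definition generator_pairs :: "('a \<times> 'b) set"
  where "generator_pairs =
    {((P ^^ k) (defect_op (adj P) f), (P' ^^ k) (defect_op (adj P') (v f))) |k f. f \<in> defect_space (adj P)}
    \<union> {((adj P ^^ k) (defect_op P g), (adj P' ^^ k) (defect_op P' (u g))) |k g. g \<in> defect_space P}"

lemma gram_generator_pairs:
  assumes "p \<in> generator_pairs" "q \<in> generator_pairs"
  shows "inner (fst p) (fst q) = inner (snd p) (snd q)"
proof -
  note dual_gram = coefficient_coincidence.gram_power_power[OF dual, unfolded adj_adj_simps]
  have "inner ((adj P ^^ k) (defect_op P g)) ((P ^^ m) (defect_op (adj P) f))
    = inner ((adj P' ^^ k) (defect_op P' (u g))) ((P' ^^ m) (defect_op (adj P') (v f)))"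
    if "f \<in> defect_space (adj P)" "g \<in> defect_space P" for f g k m
    using gram_power_adj_power[OF that, of m k] by (simp only: inner_commute)
  with assms show ?thesis
    unfolding generator_pairs_def by (auto simp: gram_power_power gram_power_adj_power dual_gram)
qed

text \<open>The graph is a closed real span, so complex homogeneity of the resulting operator has to
  come from the generators.\<close>

lemma generator_pairs_scaleC:
  assumes "p \<in> generator_pairs"
  shows "(c *\<^sub>C fst p, c *\<^sub>C snd p) \<in> generator_pairs"
proof -
  note scale = bop_scaleC[OF bop_funpow] bop_scaleC[OF bop_defect_op]
  have "(c *\<^sub>C (P ^^ k) (defect_op (adj P) f), c *\<^sub>C (P' ^^ k) (defect_op (adj P') (v f)))
      = ((P ^^ k) (defect_op (adj P) (c *\<^sub>C f)), (P' ^^ k) (defect_op (adj P') (v (c *\<^sub>C f))))"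
    if "f \<in> defect_space (adj P)" for f k
    by (simp add: scale bops contractive_adj P P' unitary_op_scaleC[OF v that])
  moreover have "(c *\<^sub>C (adj P ^^ k) (defect_op P g), c *\<^sub>C (adj P' ^^ k) (defect_op P' (u g)))
      = ((adj P ^^ k) (defect_op P (c *\<^sub>C g)), (adj P' ^^ k) (defect_op P' (u (c *\<^sub>C g))))"
    if "g \<in> defect_space P" for g k
    by (simp add: scale bops contractive_adj P P' unitary_op_scaleC[OF u that])
  ultimately show ?thesis
    using assms scaleC_in_defect_space[OF P] scaleC_in_defect_space[OF contractive_adj[OF P]]
    unfolding generator_pairs_def by fastforce
qed

lemma generator_pairs_power: "f \<in> defect_space (adj P) \<Longrightarrow>
    ((P ^^ k) (defect_op (adj P) f), (P' ^^ k) (defect_op (adj P') (v f))) \<in> generator_pairs"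
  and generator_pairs_adj_power: "g \<in> defect_space P \<Longrightarrow>
    ((adj P ^^ k) (defect_op P g), (adj P' ^^ k) (defect_op P' (u g))) \<in> generator_pairs"
  unfolding generator_pairs_def by blast+

text \<open>\<open>P\<close> shifts the first family. On the second, with \<open>D\<close> and
  \<open>E\<close> the defect operators of \<open>P\<close> and \<open>adj P\<close>, the relation
  \<open>P D = E P\<close> settles \<open>k = 0\<close>, and \<open>P P* = 1 - E^2\<close> turns the
  image for \<open>k = j + 1\<close> into a difference of two generators. The coefficient relations
  match the primed components.\<close>

lemma generator_pairs_contraction:
  assumes "p \<in> generator_pairs"
  shows "(P (fst p), P' (snd p)) \<in> closure (span generator_pairs)"
proof -
  let ?G = generator_pairs
  have "(P ((adj P ^^ k) (defect_op P g)), P' ((adj P' ^^ k) (defect_op P' (u g)))) \<in> span ?G"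
    if g: "g \<in> defect_space P" for k g
  proof (cases k)
    case 0
    have "(defect_op (adj P) (P g), defect_op (adj P') (v (P g))) \<in> ?G"
      using generator_pairs_power[of "P g" 0] contraction_in_defect_space[OF P g] by simp
    thus ?thesis
      using 0 g by (simp add: contraction_defect_op P P' constant_coefficient span_base)
  next
    case (Suc j)
    let ?x = "(adj P ^^ j) (defect_op P g)" and ?x' = "(adj P' ^^ j) (defect_op P' (u g))"
    have "(?x, ?x') \<in> ?G" by (rule generator_pairs_adj_power[OF g])
    moreover have "(defect_op (adj P) (defect_op (adj P) ?x), defect_op (adj P') (defect_op (adj P') ?x')) \<in> ?G"
      using generator_pairs_power[of "defect_op (adj P) ?x" 0]
          defect_op_in_defect_space[OF contractive_adj[OF P]]
      by (simp add: higher_coefficient g)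
    ultimately have "(?x, ?x') - (defect_op (adj P) (defect_op (adj P) ?x), defect_op (adj P') (defect_op (adj P') ?x')) \<in> span ?G"
      by (intro span_diff span_base)
    thus ?thesis using Suc by (simp add: defect_op_adj_defect_op_adj P P')
  qed
  moreover have "(P ((P ^^ k) (defect_op (adj P) f)), P' ((P' ^^ k) (defect_op (adj P') (v f)))) \<in> span ?G"
    if "f \<in> defect_space (adj P)" for f k
    using generator_pairs_power[OF that, of "Suc k"] by (simp add: span_base)
  ultimately have "(P (fst p), P' (snd p)) \<in> span ?G"
    using assms unfolding generator_pairs_def[unfolded Un_def] by auto
  thus ?thesis using closure_subset by (rule rev_subsetD)
qed

text \<open>Testing \<open>x\<close> against the generator built from
  \<open>f = defect_op (adj P) ((adj P ^^ k) x)\<close> gives \<open>inner f f = 0\<close>, and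
  likewise for the other family, so \<open>cnu_trivial\<close> applies. On the primed side,
  surjectivity of \<open>u\<close> and \<open>v\<close> provides the preimages.\<close>

lemma generator_pairs_dense:
  assumes "cnu P" "cnu P'"
  shows "closure (span (fst ` generator_pairs)) = UNIV" "closure (span (snd ` generator_pairs)) = UNIV"
proof -
  show "closure (span (fst ` generator_pairs)) = UNIV"
  proof (rule dense_if_orthogonal_trivial, rule cnu_trivial[OF P \<open>cnu P\<close>])
    fix x k assume x: "\<And>y. y \<in> fst ` generator_pairs \<Longrightarrow> inner x y = 0"
    let ?f = "defect_op (adj P) ((adj P ^^ k) x)" and ?g = "defect_op P ((P ^^ k) x)"
    have "inner x ((P ^^ k) (defect_op (adj P) ?f)) = 0"
      by (rule x, rule image_eqI[OF _ generator_pairs_power[OF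
          defect_op_in_defect_space[OF contractive_adj[OF P]]]])
        simp
    hence "inner ?f ?f = 0"
      by (simp add: inner_funpow_adj[OF bops(3), unfolded adj_adj_simps]
          defect_op_symmetric contractive_adj P)
    thus "?f = 0" by simp
    have "inner x ((adj P ^^ k) (defect_op P ?g)) = 0"
      by (rule x, rule image_eqI[OF _ generator_pairs_adj_power[OF
          defect_op_in_defect_space[OF P]]]) simp
    hence "inner ?g ?g = 0"
      by (simp add: inner_funpow_adj[OF bops(1)] defect_op_symmetric contractive_adj P)
    thus "?g = 0" by simp
  qed
  show "closure (span (snd ` generator_pairs)) = UNIV"
  proof (rule dense_if_orthogonal_trivial, rule cnu_trivial[OF P' \<open>cnu P'\<close>])
    fix x k assume x: "\<And>y. y \<in> snd ` generator_pairs \<Longrightarrow> inner x y = 0"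
    let ?f = "defect_op (adj P') ((adj P' ^^ k) x)" and ?g = "defect_op P' ((P' ^^ k) x)"
    have "?f \<in> v ` defect_space (adj P)" "?g \<in> u ` defect_space P"
      using u v defect_op_in_defect_space P' contractive_adj unfolding unitary_op_def by metis+
    then obtain f g where f: "f \<in> defect_space (adj P)" "v f = ?f"
        and g: "g \<in> defect_space P" "u g = ?g"
      by (metis imageE)
    have "inner x ((P' ^^ k) (defect_op (adj P') ?f)) = 0"
      by (rule x, rule image_eqI[OF _ generator_pairs_power[OF f(1)]]) (simp add: f)
    hence "inner ?f ?f = 0"
      by (simp add: inner_funpow_adj[OF bops(4), unfolded adj_adj_simps]
          defect_op_symmetric contractive_adj P')
    thus "?f = 0" by simp
    have "inner x ((adj P' ^^ k) (defect_op P' ?g)) = 0"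
      by (rule x, rule image_eqI[OF _ generator_pairs_adj_power[OF g(1)]]) (simp add: g)
    hence "inner ?g ?g = 0"
      by (simp add: inner_funpow_adj[OF bops(2)] defect_op_symmetric contractive_adj P')
    thus "?g = 0" by simp
  qed
qed

lemma unitary_extending:
  assumes cnu: "cnu P" "cnu P'"
  obtains U where "unitary_op UNIV UNIV U" "\<And>x. U (P x) = P' (U x)"
    "\<And>x. x \<in> defect_space P \<Longrightarrow> U x = u x" "\<And>x. x \<in> defect_space (adj P) \<Longrightarrow> U x = v x"
proof -
  let ?V = "closure (span generator_pairs)"
  obtain U where U: "bounded_linear U" "surj U" "\<And>x. norm (U x) = norm x"
    and UV: "\<And>p. p \<in> ?V \<longleftrightarrow> snd p = U (fst p)"
    using isometry_of_equal_gram[OF gram_generator_pairs generator_pairs_dense[OF cnu]] by metis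
  have UV': "(x, y) \<in> ?V \<longleftrightarrow> y = U x" for x y by (simp add: UV)
  have G: "p \<in> generator_pairs \<Longrightarrow> p \<in> ?V" for p
    by (meson closure_subset span_superset subsetD)
  \<comment> \<open>\<open>?V\<close> is the graph of \<open>U\<close>, so its invariance under the
    product map of \<open>A\<close> and \<open>B\<close> says that \<open>U\<close> intertwines
    \<open>A\<close> and \<open>B\<close>; this only has to be checked on generators.\<close>
  have pair: "(A x, B (U x)) \<in> ?V"
    if "bounded_linear A" "bounded_linear B" "\<And>p. p \<in> generator_pairs \<Longrightarrow> (A (fst p), B (snd p)) \<in> ?V"
    for A B x
    using closure_span_invariant[of "\<lambda>p. (A (fst p), B (snd p))" generator_pairs "(x, U x)"] that UV'
    by (simp add: bounded_linear_Pair bounded_linear_compose[OF _ bounded_linear_fst]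
        bounded_linear_compose[OF _ bounded_linear_snd])
  have Uscale: "U (c *\<^sub>C x) = c *\<^sub>C U x" for c x
    using pair[of "\<lambda>x. c *\<^sub>C x" "\<lambda>x. c *\<^sub>C x" x, OF bounded_linear_scaleC bounded_linear_scaleC
        G[OF generator_pairs_scaleC]] by (simp add: UV')
  have UP: "U (P x) = P' (U x)" for x
    using pair[of P P' x, OF bop_bounded_linear[OF bops(1)] bop_bounded_linear[OF bops(2)]
        generator_pairs_contraction] by (simp add: UV')
  have bU: "bop U" using U(1) Uscale by (simp add: bop_iff)
  have "inner (U x) (U y) = inner x y" for x y
    using U(3)[of "x + y"] U(3)[of x] U(3)[of y]
    by (simp add: bop_add[OF bU] dot_norm)
  hence "cinner (U x) (U y) = cinner x y" for x y
    by (simp add: complex_eq_iff Re_cinner Im_cinner flip: Uscale)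
  hence uU: "unitary_op UNIV UNIV U"
    using U(2) bU by (auto simp: unitary_op_def clinear_on_def bop_add Uscale)
  have UA: "U (adj P x) = adj P' (U x)" for x
    by (rule unitary_op_adj[OF uU bops(1,2) UP])
  have UD: "U (defect_op P x) = defect_op P' (U x)" for x
    by (rule defect_op_intertwine[OF P P' bU]) (simp add: UP UA)
  have UE: "U (defect_op (adj P) x) = defect_op (adj P') (U x)" for x
    by (rule defect_op_intertwine[OF contractive_adj[OF P] contractive_adj[OF P'] bU])
      (simp add: UP UA adj_adj_simps)
  \<comment> \<open>Both sides lie in the defect space of \<open>P'\<close>, where the defect
    operator is injective, and the generator pair with \<open>k = 0\<close> says that their images
    under it agree.\<close>
  have "U x = u x" if x: "x \<in> defect_space P" for x
  proof -
    have "U x \<in> defect_space P'"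
      by (rule bop_maps_defect_space[OF P bU _ _ x])
        (simp_all add: UD defect_op_in_defect_space P', simp add: defect_space_def)
    hence "U x - u x \<in> defect_space P'"
      by (rule subspace_diff[OF subspace_defect_space[OF P'] _ unitary_op_in[OF u x]])
    moreover have "U (defect_op P x) = defect_op P' (u x)"
      using G[OF generator_pairs_adj_power[OF x, of 0]] by (simp add: UV)
    hence "defect_op P' (U x - u x) = 0" by (simp add: UD bop_diff[OF bop_defect_op[OF P']])
    ultimately show ?thesis using defect_op_injective[OF P'] by fastforce
  qed
  moreover have "U x = v x" if x: "x \<in> defect_space (adj P)" for x
  proof -
    note cP' = contractive_adj[OF P']
    have "U x \<in> defect_space (adj P')"
      by (rule bop_maps_defect_space[OF contractive_adj[OF P] bU _ _ x])
        (simp_all add: UE defect_op_in_defect_space cP', simp add: defect_space_def)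
    hence "U x - v x \<in> defect_space (adj P')"
      by (rule subspace_diff[OF subspace_defect_space[OF cP'] _ unitary_op_in[OF v x]])
    moreover have "U (defect_op (adj P) x) = defect_op (adj P') (v x)"
      using G[OF generator_pairs_power[OF x, of 0]] by (simp add: UV)
    hence "defect_op (adj P') (U x - v x) = 0" by (simp add: UE bop_diff[OF bop_defect_op[OF cP']])
    ultimately show ?thesis using defect_op_injective[OF cP'] by fastforce
  qed
  ultimately show thesis using that[OF uU UP] by blast
qed

end

text \<open>The value at \<open>z = 0\<close> gives the constant coefficient; removing it and
  dividing by \<open>z\<close> leaves an identity between resolvents on the punctured disc, whose
  coefficients can be compared.\<close>

lemma char_fun_coincidence_coefficients:
  fixes P :: "'a::complex_hilbert \<Rightarrow> 'a" and P' :: "'b::complex_hilbert \<Rightarrow> 'b"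
  assumes P: "contractive P" and P': "contractive P'" and co: "char_fun_coincidence P P' u v"
  shows "coefficient_coincidence P P' u v"
proof
  show u: "unitary_op (defect_space P) (defect_space P') u"
    and v: "unitary_op (defect_space (adj P)) (defect_space (adj P')) v"
    using co by (simp_all add: char_fun_coincidence_def)
  have eq: "v (char_fun P z x) = char_fun P' z (u x)" if "cmod z < 1" "x \<in> defect_space P" for z x
    using co that by (simp add: char_fun_coincidence_def)
  note cA = contractive_adj[OF P] and cA' = contractive_adj[OF P']
  fix x assume x: "x \<in> defect_space P"
  note Px = contraction_in_defect_space[OF P x]
  \<comment> \<open>\<open>v\<close> is linear on the defect space only, so signs are pulled through
    it as multiplication by the scalar -1.\<close>
  have minus: "- y = (- 1) *\<^sub>C y" for y :: "'c::complex_inner"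
    using scaleC_complex_of_real[of "-1" y] by simp
  have neg: "v (- P x) = - v (P x)"
    using unitary_op_scaleC[OF v Px, of "- 1"] by (simp flip: minus)
  show const: "v (P x) = P' (u x)"
    using eq[of 0 x] x neg by (simp add: char_fun_def)
  have nPx: "- P x \<in> defect_space (adj P)"
    using scaleC_in_defect_space[OF cA Px, of "- 1"] by (simp flip: minus)
  let ?T = "\<lambda>y. v (defect_op (adj P) y)"
  have T: "bop ?T"
    by (rule unitary_op_bop_compose[OF v bop_defect_op[OF cA] defect_op_in_defect_space[OF cA]])
  have "?T (resolvent (adj P) z (defect_op P x))
      = defect_op (adj P') (resolvent (adj P') z (defect_op P' (u x)))"
    if z: "cmod z < 1" "z \<noteq> 0" for z
  proof -
    let ?r = "defect_op (adj P) (resolvent (adj P) z (defect_op P x))"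
    have r: "?r \<in> defect_space (adj P)" by (rule defect_op_in_defect_space[OF cA])
    have "v (char_fun P z x) = - P' (u x) + z *\<^sub>C v ?r"
      unfolding char_fun_def unitary_op_add[OF v nPx scaleC_in_defect_space[OF cA r]]
        unitary_op_scaleC[OF v r] neg const ..
    hence "z *\<^sub>C v ?r = z *\<^sub>C defect_op (adj P') (resolvent (adj P') z (defect_op P' (u x)))"
      using eq[OF z(1) x] by (simp add: char_fun_def)
    hence "inverse z *\<^sub>C z *\<^sub>C v ?r
        = inverse z *\<^sub>C z *\<^sub>C defect_op (adj P') (resolvent (adj P') z (defect_op P' (u x)))"
      by simp
    thus ?thesis using z by (simp add: scaleC_scaleC)
  qed
  from resolvent_coefficients[OF cA cA' T bop_defect_op[OF cA'] this]
  show "v (defect_op (adj P) ((adj P ^^ k) (defect_op P x)))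
      = defect_op (adj P') ((adj P' ^^ k) (defect_op P' (u x)))" for k .
qed (rule P P')+

section \<open>\<open>\<Gamma>\<^sub>n\<close>-contractions\<close>

lemma norm_le_1_Gamma_set:
  assumes "z \<in> Gamma_set n" "n \<ge> 1"
  shows "cmod (z n) \<le> 1"
proof -
  obtain w where w: "\<forall>i\<in>{1..n}. cmod (w i) \<le> 1" "z n = elem_sym n n w"
    using assms unfolding Gamma_set_def by auto
  have "{J. J \<subseteq> {1..n} \<and> card J = n} = {{1..n}}"
    using card_subset_eq[of "{1..n}"] by auto
  hence "z n = (\<Prod>j\<in>{1..n}. w j)" by (simp add: w(2) elem_sym_def)
  thus ?thesis using w(1) by (auto simp: prod_norm[symmetric] intro!: prod_le_1)
qed

text \<open>Keeps the supremum in the spectral set condition from being taken over the empty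
  set.\<close>

lemma zero_in_Gamma_set: "(\<lambda>i. 0) \<in> Gamma_set n"
proof -
  have "elem_sym n k (\<lambda>i. 0) = 0" if "k \<ge> 1" for k
    unfolding elem_sym_def
  proof (rule sum.neutral, intro ballI)
    fix J assume "J \<in> {J. J \<subseteq> {1..n} \<and> card J = k}"
    hence "J \<noteq> {}" "finite J" using that finite_subset[of J "{1..n}"] by auto
    thus "(\<Prod>j\<in>J. 0 :: complex) = 0" by (simp add: card_gt_0_iff)
  qed
  thus ?thesis unfolding Gamma_set_def cspace_def by (auto intro!: exI[of _ "\<lambda>i. 0"])
qed

lemma Gamma_contraction_contractive:
  assumes "Gamma_contraction n S P" "n \<ge> 1"
  shows "contractive P"
proof -
  let ?T = "S(n := P)"
  \<comment> \<open>\<open>p\<close> is the coordinate \<open>z n\<close> and \<open>q\<close> is 1;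
    on \<open>Gamma_set n\<close> that coordinate is a product of numbers of modulus at most
    1.\<close>
  define p q :: cpoly where "p = Poly_Mapping.single (Poly_Mapping.single n 1) 1" and "q = 1"
  have pq: "p \<in> polys n" "q \<in> polys n" using assms(2) by (auto simp: p_def q_def polys_def)
  have val: "poly_val p z = z n" "poly_val q z = 1" for z
    by (simp_all add: poly_val_def p_def q_def)
  have op: "poly_op p ?T = P" "poly_op q ?T = id"
    by (simp_all add: fun_eq_iff poly_op_def monom_op_def p_def q_def)
  have "onorm (poly_op p ?T \<circ> inv (poly_op q ?T))
      \<le> (SUP z\<in>Gamma_set n. cmod (poly_val p z / poly_val q z))"
    using assms(1) pq val unfolding Gamma_contraction_def spectral_set_def by fastforce
  also have "\<dots> \<le> 1"
    by (rule cSUP_least) (use zero_in_Gamma_set norm_le_1_Gamma_set assms(2) in \<open>auto simp: val\<close>)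
  finally have "onorm P \<le> 1" by (simp add: op)
  have "bounded_op UNIV UNIV (?T n)"
    using assms unfolding Gamma_contraction_def commuting_tuple_def
    by (meson atLeastAtMost_iff order_refl)
  hence bP: "bop P" by simp
  moreover have "norm (P x) \<le> norm x" for x
    using onorm[OF bop_bounded_linear[OF bP], of x] mult_right_mono[OF \<open>onorm P \<le> 1\<close>, of "norm x"]
    by simp
  ultimately show ?thesis by (simp add: contractive_def)
qed

lemma Gamma_contraction_bop:
  assumes "Gamma_contraction n S P" "i \<in> {1..<n}"
  shows "bop (S i)"
proof -
  have "i \<in> {1..n}" using assms(2) by simp
  hence "bounded_op UNIV UNIV ((S(n := P)) i)"
    using assms(1) unfolding Gamma_contraction_def commuting_tuple_def by blast
  thus ?thesis using assms(2) by simp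
qed

lemma Gamma_contraction_commute:
  assumes "Gamma_contraction n S P" "i \<in> {1..<n}"
  shows "S i (P x) = P (S i x)"
proof -
  have "i \<in> {1..n}" "n \<in> {1..n}" using assms(2) by auto
  hence "(S(n := P)) i \<circ> (S(n := P)) n = (S(n := P)) n \<circ> (S(n := P)) i"
    using assms(1) unfolding Gamma_contraction_def commuting_tuple_def by blast
  thus ?thesis using assms(2) by (auto simp: fun_eq_iff)
qed

section \<open>Transport along an intertwining operator\<close>

lemma FO_operator_intertwine:
  fixes P :: "'a::complex_hilbert \<Rightarrow> 'a" and P' :: "'b::complex_hilbert \<Rightarrow> 'b"
  assumes P: "contractive P" and P': "contractive P'"
    and A: "bounded_op (defect_space P) (defect_space P) A"
    and A': "bounded_op (defect_space P') (defect_space P') A'"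
    and U: "bop U" "\<And>x. U (defect_op P x) = defect_op P' (U x)"
    and eq: "\<And>x. U (defect_op P (A (defect_op P x))) = defect_op P' (A' (defect_op P' (U x)))"
    and x: "x \<in> defect_space P"
  shows "U (A x) = A' (U x)"
proof -
  have UD: "U y \<in> defect_space P'" if "y \<in> defect_space P" for y
    by (rule bop_maps_defect_space[OF P U(1) _ _ that])
      (simp_all add: U(2) defect_op_in_defect_space P', simp add: defect_space_def)
  have Ain: "A y \<in> defect_space P" if "y \<in> defect_space P" for y
    using A that unfolding bounded_op_def by blast
  have A'in: "A' y \<in> defect_space P'" if "y \<in> defect_space P'" for y
    using A' that unfolding bounded_op_def by blast
  \<comment> \<open>Cancelling \<open>defect_op P'\<close> on the left, by its injectivity on the
    defect space, settles the range of \<open>defect_op P\<close>.\<close>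
  have on_range: "U (A (defect_op P y)) = A' (U (defect_op P y))" for y
  proof -
    have y: "defect_op P y \<in> defect_space P" by (rule defect_op_in_defect_space[OF P])
    have "defect_op P' (U (A (defect_op P y)) - A' (U (defect_op P y))) = 0"
      using eq[of y] by (simp add: bop_diff[OF bop_defect_op[OF P']] flip: U(2))
    moreover have "U (A (defect_op P y)) - A' (U (defect_op P y)) \<in> defect_space P'"
      by (intro subspace_diff[OF subspace_defect_space[OF P']] UD A'in Ain y)
    ultimately show ?thesis using defect_op_injective[OF P'] by fastforce
  qed
  \<comment> \<open>\<open>A\<close> and \<open>A'\<close> are controlled on the defect spaces only,
    so continuity is proved relative to a domain \<open>M\<close>.\<close>
  have lim: "(\<lambda>k. C (f k)) \<longlonglongrightarrow> C l"
    if C: "bounded_op M N C" and M: "subspace M" "\<And>k. f k \<in> M" "l \<in> M" "f \<longlonglongrightarrow> l"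
    for C :: "'c::complex_inner \<Rightarrow> 'd::complex_inner" and M N f l
  proof -
    obtain K where K: "\<And>y. y \<in> M \<Longrightarrow> norm (C y) \<le> K * norm y"
      using C unfolding bounded_op_def by blast
    have diff: "C (f k) - C l = C (f k - l)" for k
    proof -
      have "C ((f k - l) + l) = C (f k - l) + C l"
        using C subspace_diff[OF M(1) M(2) M(3)] M(3) unfolding bounded_op_def clinear_on_def by blast
      thus ?thesis by simp
    qed
    have "(\<lambda>k. C (f k) - C l) \<longlonglongrightarrow> 0"
    proof (rule Lim_null_comparison)
      show "\<forall>\<^sub>F k in sequentially. norm (C (f k) - C l) \<le> K * norm (f k - l)"
        unfolding diff by (intro always_eventually allI K subspace_diff M)
      show "(\<lambda>k. K * norm (f k - l)) \<longlonglongrightarrow> 0"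
        using tendsto_mult_right_zero[OF tendsto_norm_zero[OF LIM_zero[OF M(4)]]] by blast
    qed
    thus ?thesis by (rule LIM_zero_cancel)
  qed
  obtain f where "\<And>k. f k \<in> range (defect_op P)" and fx: "f \<longlonglongrightarrow> x"
    using x unfolding defect_space_def closure_sequential by blast
  then have f: "U (A (f k)) = A' (U (f k))" "f k \<in> defect_space P" for k
    using on_range defect_op_in_defect_space[OF P] by (metis imageE)+
  have "(\<lambda>k. U (A (f k))) \<longlonglongrightarrow> U (A x)"
    by (intro bop_tendsto[OF U(1)] lim[OF A subspace_defect_space[OF P] f(2) x fx])
  moreover have "(\<lambda>k. U (A (f k))) \<longlonglongrightarrow> A' (U x)"
    unfolding f(1)
    by (rule lim[OF A' subspace_defect_space[OF P'] UD[OF f(2)] UD[OF x] bop_tendsto[OF U(1) fx]])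
  ultimately show ?thesis by (rule LIMSEQ_unique)
qed

text \<open>\<open>U\<close> sends the solution of \<open>y - z P* y = w\<close> to the solution of
  the primed equation, hence intertwines the resolvents.\<close>

lemma char_fun_unitary_transport:
  fixes P :: "'a::complex_hilbert \<Rightarrow> 'a" and P' :: "'b::complex_hilbert \<Rightarrow> 'b"
  assumes P: "contractive P" and P': "contractive P'" and U: "bop U"
    and UP: "\<And>x. U (P x) = P' (U x)" and UA: "\<And>x. U (adj P x) = adj P' (U x)"
    and UD: "\<And>x. U (defect_op P x) = defect_op P' (U x)"
    and UE: "\<And>x. U (defect_op (adj P) x) = defect_op (adj P') (U x)"
    and z: "cmod z < 1"
  shows "U (char_fun P z x) = char_fun P' z (U x)"
proof -
  note b = bij_one_minus_contraction[OF contractive_adj[OF P] z]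
    and b' = bij_one_minus_contraction[OF contractive_adj[OF P'] z]
  have "U (resolvent (adj P) z w) = resolvent (adj P') z (U w)" for w
  proof -
    let ?y = "resolvent (adj P) z w"
    have "?y - z *\<^sub>C adj P ?y = w" by (rule surj_f_inv_f[OF bij_is_surj[OF b]])
    hence "U ?y - z *\<^sub>C adj P' (U ?y) = U w"
      by (metis bop_diff[OF U] bop_scaleC[OF U] UA)
    thus ?thesis by (metis bij_inv_eq_iff[OF b'])
  qed
  thus ?thesis
    by (simp add: char_fun_def bop_add[OF U] bop_minus[OF U] bop_diff[OF U] bop_scaleC[OF U] UP UD UE)
qed

text \<open>Onto because the isometric image of the complete defect space is closed and contains the
  range of \<open>defect_op P'\<close>.\<close>

lemma unitary_op_defect_space:
  fixes P :: "'a::complex_hilbert \<Rightarrow> 'a" and P' :: "'b::complex_hilbert \<Rightarrow> 'b"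
  assumes P: "contractive P" and P': "contractive P'" and U: "unitary_op UNIV UNIV U"
    and UD: "\<And>x. U (defect_op P x) = defect_op P' (U x)"
  shows "unitary_op (defect_space P) (defect_space P') U"
proof -
  have bU: "bop U" by (rule unitary_op_bop[OF U])
  have "U ` defect_space P = defect_space P'"
  proof
    show "U ` defect_space P \<subseteq> defect_space P'"
    proof (rule image_subsetI, rule bop_maps_defect_space[OF P bU])
      show "closed (defect_space P')" by (simp add: defect_space_def)
      show "U (defect_op P x) \<in> defect_space P'" for x
        by (simp add: UD defect_op_in_defect_space[OF P'])
    qed
    have "complete (U ` defect_space P)"
    proof (rule complete_isometric_image[of 1])
      show "subspace (defect_space P)" by (rule subspace_defect_space[OF P])
      show "complete (defect_space P)" by (simp add: defect_space_def complete_eq_closed)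
    qed (simp_all add: bop_bounded_linear[OF bU] unitary_op_norm[OF U])
    moreover have "range (defect_op P') \<subseteq> U ` defect_space P"
    proof (rule image_subsetI)
      fix y
      obtain x where "y = U x" using U unfolding unitary_op_def by blast
      thus "defect_op P' y \<in> U ` defect_space P"
        by (simp add: defect_op_in_defect_space[OF P] flip: UD)
    qed
    ultimately show "defect_space P' \<subseteq> U ` defect_space P"
      unfolding defect_space_def[of P'] by (intro closure_minimal complete_imp_closed)
  qed
  with U show ?thesis by (simp add: unitary_op_def clinear_on_def)
qed

lemma adj_commute:
  fixes P S :: "'a::complex_hilbert \<Rightarrow> 'a"
  assumes P: "bop P" and S: "bop S" and comm: "\<And>x. adj S (P x) = P (adj S x)"
  shows "S (adj P x) = adj P (S x)"
proof (rule cinner_cancel_right)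
  fix y
  have S': "cinner (adj S y) x = cinner y (S x)" for x y
    using cinner_adj[OF bop_adj[OF S], of y x] adj_adj[OF S] by simp
  show "cinner y (S (adj P x)) = cinner y (adj P (S x))"
    by (simp add: comm flip: S' cinner_adj[OF P])
qed

lemma FO_tuple_bounded: "FO_tuple n S P A \<Longrightarrow> i \<in> {1..<n}
    \<Longrightarrow> bounded_op (defect_space P) (defect_space P) (A i)"
  and FO_tuple_eq: "FO_tuple n S P A \<Longrightarrow> i \<in> {1..<n} \<Longrightarrow>
    S i x - adj (S (n - i)) (P x) = defect_op P (A i (defect_op P x))"
  by (auto simp: FO_tuple_def)

theorem theorem5p5:
  fixes n :: nat
    and S A B :: "nat \<Rightarrow> 'a::complex_hilbert \<Rightarrow> 'a" and P :: "'a \<Rightarrow> 'a"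
    and S' A' B' :: "nat \<Rightarrow> 'b::complex_hilbert \<Rightarrow> 'b" and P' :: "'b \<Rightarrow> 'b"
  assumes "n \<ge> 2"
    and "Gamma_contraction n S P" and "cnu P"
    and "Gamma_contraction n S' P'" and "cnu P'"
    and "\<forall>i\<in>{1..<n}. adj (S i) \<circ> P = P \<circ> adj (S i)"
    and "\<forall>i\<in>{1..<n}. adj (S' i) \<circ> P' = P' \<circ> adj (S' i)"
    and "FO_tuple n S P A" and "FO_tuple n S' P' A'"
    and "FO_tuple n (\<lambda>i. adj (S i)) (adj P) B" and "FO_tuple n (\<lambda>i. adj (S' i)) (adj P') B'"
  shows "unitarily_equivalent n S P S' P' \<longleftrightarrow>
    (\<exists>u v. char_tuple_C_equiv n A P A' P' u v \<and> adj_FO_tuple_C_equiv n B P B' P' u v)"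
proof -
  have P: "contractive P" and P': "contractive P'"
    using Gamma_contraction_contractive assms(1,2,4) by fastforce+
  note cA = contractive_adj[OF P] and cA' = contractive_adj[OF P']
  note bP = contractive_bop[OF P] and bP' = contractive_bop[OF P']
  note bS = Gamma_contraction_bop[OF assms(2)] and bS' = Gamma_contraction_bop[OF assms(4)]
  have PP: "adj (adj P) = P" "adj (adj P') = P'" using adj_adj bP bP' by blast+
  have flip: "n - i \<in> {1..<n}" if "i \<in> {1..<n}" for i using that by auto
  note A = FO_tuple_eq[OF assms(8)] and A' = FO_tuple_eq[OF assms(9)]
  have B: "adj (S i) x - S (n - i) (adj P x) = defect_op (adj P) (B i (defect_op (adj P) x))"
    if "i \<in> {1..<n}" for i x
    using FO_tuple_eq[OF assms(10) that, of x] adj_adj[OF bS[OF flip[OF that]]] by simp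
  have B': "adj (S' i) x - S' (n - i) (adj P' x) = defect_op (adj P') (B' i (defect_op (adj P') x))"
    if "i \<in> {1..<n}" for i x
    using FO_tuple_eq[OF assms(11) that, of x] adj_adj[OF bS'[OF flip[OF that]]] by simp
  show ?thesis
  proof
    assume "unitarily_equivalent n S P S' P'"
    then obtain U where U: "unitary_op UNIV UNIV U"
      and US0: "\<forall>i\<in>{1..<n}. U \<circ> S i = S' i \<circ> U" and UP0: "U \<circ> P = P' \<circ> U"
      unfolding unitarily_equivalent_def by blast
    have bU: "bop U" by (rule unitary_op_bop[OF U])
    have US: "U (S i x) = S' i (U x)" if "i \<in> {1..<n}" for i x
      using US0 that by (metis comp_apply)
    have UP: "U (P x) = P' (U x)" for x using UP0 by (metis comp_apply)
    have USadj: "U (adj (S i) x) = adj (S' i) (U x)" if "i \<in> {1..<n}" for i x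
      by (rule unitary_op_adj[OF U bS[OF that] bS'[OF that] US[OF that]])
    have UA: "U (adj P x) = adj P' (U x)" for x
      by (rule unitary_op_adj[OF U bP bP' UP])
    have UD: "U (defect_op P x) = defect_op P' (U x)" for x
      by (rule defect_op_intertwine[OF P P' bU]) (simp add: UP UA)
    have UE: "U (defect_op (adj P) x) = defect_op (adj P') (U x)" for x
      by (rule defect_op_intertwine[OF cA cA' bU]) (simp add: UP UA PP)
    \<comment> \<open>One \<open>U\<close> plays both parts of the coincidence, restricted to the
      two defect spaces.\<close>
    have co: "char_fun_coincidence P P' U U"
      unfolding char_fun_coincidence_def
      using unitary_op_defect_space[OF P P' U UD] unitary_op_defect_space[OF cA cA' U UE]
        char_fun_unitary_transport[OF P P' bU UP UA UD UE] by simp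
    have "U (A i x) = A' i (U x)" if i: "i \<in> {1..<n}" and x: "x \<in> defect_space P" for i x
      by (rule FO_operator_intertwine[OF P P' FO_tuple_bounded[OF assms(8) i]
          FO_tuple_bounded[OF assms(9) i] bU UD _ x])
        (simp add: A[OF i, symmetric] A'[OF i, symmetric]
            bop_diff[OF bU] US[OF i] USadj[OF flip[OF i]] UP)
    moreover have "U (B i x) = B' i (U x)" if i: "i \<in> {1..<n}" and x: "x \<in> defect_space (adj P)" for i x
      by (rule FO_operator_intertwine[OF cA cA' FO_tuple_bounded[OF assms(10) i]
          FO_tuple_bounded[OF assms(11) i] bU UE _ x])
        (simp add: B[OF i, symmetric] B'[OF i, symmetric]
            bop_diff[OF bU] USadj[OF i] US[OF flip[OF i]] UA)
    ultimately show "\<exists>u v. char_tuple_C_equiv n A P A' P' u v \<and> adj_FO_tuple_C_equiv n B P B' P' u v"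
      using co unfolding char_tuple_C_equiv_def adj_FO_tuple_C_equiv_def by blast
  next
    assume "\<exists>u v. char_tuple_C_equiv n A P A' P' u v \<and> adj_FO_tuple_C_equiv n B P B' P' u v"
    then obtain u v where co: "char_fun_coincidence P P' u v"
      and uA: "\<And>i x. i \<in> {1..<n} \<Longrightarrow> x \<in> defect_space P \<Longrightarrow> u (A i x) = A' i (u x)"
      and vB: "\<And>i x. i \<in> {1..<n} \<Longrightarrow> x \<in> defect_space (adj P) \<Longrightarrow> v (B i x) = B' i (v x)"
      unfolding char_tuple_C_equiv_def adj_FO_tuple_C_equiv_def by blast
    interpret coefficient_coincidence P P' u v
      by (rule char_fun_coincidence_coefficients[OF P P' co])
    obtain U where U: "unitary_op UNIV UNIV U" and UP: "\<And>x. U (P x) = P' (U x)"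
      and Uu: "\<And>x. x \<in> defect_space P \<Longrightarrow> U x = u x"
      and Uv: "\<And>x. x \<in> defect_space (adj P) \<Longrightarrow> U x = v x"
      by (rule unitary_extending[OF assms(3,5)]) blast
    have bU: "bop U" by (rule unitary_op_bop[OF U])
    have UA: "U (adj P x) = adj P' (U x)" for x
      by (rule unitary_op_adj[OF U bP bP' UP])
    have UD: "U (defect_op P x) = defect_op P' (U x)" for x
      by (rule defect_op_intertwine[OF P P' bU]) (simp add: UP UA)
    have UE: "U (defect_op (adj P) x) = defect_op (adj P') (U x)" for x
      by (rule defect_op_intertwine[OF cA cA' bU]) (simp add: UP UA PP)
    define T where "T i x = U (S i x) - S' i (U x)" for i x
    define R where "R i x = U (adj (S i) x) - adj (S' i) (U x)" for i x
    \<comment> \<open>\<open>U\<close> carries the right side of the equation defining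
      \<open>A i\<close> to the one for \<open>A' i\<close>; comparing the left sides leaves exactly
      \<open>T i\<close> and \<open>R (n - i)\<close>.\<close>
    have TR: "T i x = R (n - i) (P x)" if i: "i \<in> {1..<n}" for i x
    proof -
      have Dx: "defect_op P x \<in> defect_space P" by (rule defect_op_in_defect_space[OF P])
      have AD: "A i (defect_op P x) \<in> defect_space P"
        using FO_tuple_bounded[OF assms(8) i] Dx unfolding bounded_op_def by blast
      have "U (defect_op P (A i (defect_op P x))) = defect_op P' (A' i (defect_op P' (U x)))"
        by (simp add: UD Uu[OF AD] uA[OF i Dx] flip: Uu[OF Dx])
      thus ?thesis
        by (simp add: T_def R_def bop_diff[OF bU] UP algebra_simps flip: A[OF i] A'[OF i])
    qed
    have RT: "R i x = T (n - i) (adj P x)" if i: "i \<in> {1..<n}" for i x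
    proof -
      have Ex: "defect_op (adj P) x \<in> defect_space (adj P)" by (rule defect_op_in_defect_space[OF cA])
      have BE: "B i (defect_op (adj P) x) \<in> defect_space (adj P)"
        using FO_tuple_bounded[OF assms(10) i] Ex unfolding bounded_op_def by blast
      have "U (defect_op (adj P) (B i (defect_op (adj P) x)))
          = defect_op (adj P') (B' i (defect_op (adj P') (U x)))"
        by (simp add: UE Uv[OF BE] vB[OF i Ex] flip: Uv[OF Ex])
      thus ?thesis
        by (simp add: T_def R_def bop_diff[OF bU] UA algebra_simps flip: B[OF i] B'[OF i])
    qed
    have adjS: "adj (S i) (P x) = P (adj (S i) x)" "adj (S' i) (P' y) = P' (adj (S' i) y)"
      if "i \<in> {1..<n}" for i x y
      using assms(6,7) that by (metis comp_apply)+
    \<comment> \<open>The adjoint form of the commutation hypothesis, which makes \<open>T i\<close>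
      intertwine the adjoints of \<open>P\<close> and \<open>P'\<close>.\<close>
    have Sadj: "S i (adj P x) = adj P (S i x)" "S' i (adj P' y) = adj P' (S' i y)"
      if i: "i \<in> {1..<n}" for i x y
      using adj_commute[of P "S i"]
          adj_commute[of P' "S' i"] adjS[OF i] bP bP' bS[OF i] bS'[OF i] by blast+
    have TP: "T i (P x) = P' (T i x)" and TA: "T i (adj P x) = adj P' (T i x)"
      and RP: "R i (P x) = P' (R i x)" if i: "i \<in> {1..<n}" for i x
      by (simp_all add: T_def R_def UP UA bop_diff bP bP' bop_adj adjS[OF i] Sadj[OF i]
          Gamma_contraction_commute[OF assms(2) i] Gamma_contraction_commute[OF assms(4) i])
    have "T i x = 0" if i: "i \<in> {1..<n}" for i x
    proof -
      have bT: "bop (T i)"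
        unfolding T_def by (intro bop_sub) (rule bop_compose[OF bU bS[OF i]],
            rule bop_compose[OF bS'[OF i] bU])
      have nni: "n - (n - i) = i" using i by auto
      have "T i y = T i (adj P (P y))" for y
        using TR[OF i, of y] RT[OF flip[OF i], of "P y"] nni by simp
      hence TDD: "T i (defect_op P (defect_op P y)) = 0" for y
        by (simp add: defect_op_defect_op[OF P] bop_diff[OF bT])
      have "T i y = T i (P (adj P y))" for y
        using TR[OF i, of y] RP[OF flip[OF i], of y] RT[OF flip[OF i], of y] TP[OF i] nni by simp
      hence TEE: "T i (defect_op (adj P) (defect_op (adj P) y)) = 0" for y
        by (simp add: defect_op_adj_defect_op_adj[OF P] bop_diff[OF bT])
      \<comment> \<open>The composition vanishes on the range of the defect operator, hence on its
        closure, from which the vectors \<open>g\<close> of the generators are taken.\<close>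
      have TD: "T i (defect_op P g) = 0" if "g \<in> defect_space P" for g
        using bop_maps_defect_space[OF P bop_compose[OF bT
            bop_defect_op[OF P]], of "{0}" g] TDD that by simp
      have TE: "T i (defect_op (adj P) f) = 0" if "f \<in> defect_space (adj P)" for f
        using bop_maps_defect_space[OF cA bop_compose[OF bT
            bop_defect_op[OF cA]], of "{0}" f] TEE that by simp
      have "T i ((P ^^ k) y) = (P' ^^ k) (T i y)" "T i ((adj P ^^ k) y) = (adj P' ^^ k) (T i y)" for k y
        by (induction k) (simp_all add: TP[OF i] TA[OF i])
      hence G: "T i y = 0" if "y \<in> fst ` generator_pairs" for y
        using that TD TE
        by (auto simp: generator_pairs_def bop_zero[OF bop_funpow[OF bP']] bop_zero[OF bop_funpow[OF
            bop_adj[OF bP']]])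
      have "span (fst ` generator_pairs) \<subseteq> {y. T i y = 0}"
        by (rule span_minimal)
            (use G in \<open>auto simp: subspace_def bop_zero[OF bT] bop_add[OF bT] bop_scaleR[OF bT]\<close>)
      moreover have "closed {y. T i y = 0}"
        by (intro closed_Collect_eq bop_continuous[OF bT] continuous_on_const)
      ultimately have "closure (span (fst ` generator_pairs)) \<subseteq> {y. T i y = 0}"
          by (rule closure_minimal)
      thus ?thesis using generator_pairs_dense[OF assms(3,5)] by blast
    qed
    hence "\<forall>i\<in>{1..<n}. U \<circ> S i = S' i \<circ> U" by (auto simp: fun_eq_iff T_def)
    moreover have "U \<circ> P = P' \<circ> U" by (simp add: fun_eq_iff UP)
    ultimately show "unitarily_equivalent n S P S' P'"
      using U unfolding unitarily_equivalent_def by blast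
  qed
qed

end
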